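(* Let $F$ be a rooted forest, $u\le w$ in $F^*$ under generalized factor order with $u$ nonempty, and $C: w=v_0\to\dots\to v_n=u$ a maximal chain of $[u,w]$ with chain id $l_1\cdots l_n$. Then $C(v_i,v_j)$ is a minimally skipped interval of $C$ if and only if one of the following holds: (a) $C(v_i,v_j)$ consists of a single strong descent; or (b) all of the following hold: $v_j$ is a principal factor of $v_i$; $l_{i+1}$ is the principal index of $v_j$ in $v_i$ (positions measured via the embedding into $w$); and $C[v_i,v_j]$ is the first admissible chain in $[v_j,v_i]$ ending at the prefix embedding of $v_j$.
   Context: A rooted forest $F$ is a disjoint union of posets each having a unique minimal element and a Hasse diagram that is an undirected tree. Every non-minimal element covers a unique element. Generalized factor order on $F^*$: $u\le w$ iff for some $i\ge0$, $u(j)\le w(i+j)$ in $F$ for $1\le j\le|u|$. Basic notions. $\hat F$ is $F$ with a new bottom $\hat0$. - A word is flat if all its letters are the same minimal element. - An embedding of $v$ into $w$ is $\eta\in\hat0^*v\hat0^*$ of length $|w|$ with $\eta(k)\le w(k)$ in $\hat F$. The prefix embedding of a prefix $p$ of $w$ is $p\hat0^{|w|-|p|}$. - In an embedding $\eta$ of $v$, $\eta(k)$ is reducible if it is non-minimal, or it is minimal and the first non-$\hat0$ letter, or it is minimal, $v$ not flat, and it is the last non-$\hat0$ letter. - In a word $w$, $w(k)$ is reducible if non-minimal, or $k=1$, or $k=|w|$ and $w$ not flat. - Reducing replaces a letter by the unique element of $\hat F$ it covers. Chain ids. A maximal chain determines embeddings $\eta_{v_0}=w$, with $\eta_{v_k}$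 obtained from $\eta_{v_{k-1}}$ by reducing the reducible letter at position $l_k$. This chain id is unique. Chains are ordered lexicographically by chain id. For an embedding $\eta$ of a non-flat word, the first admissible chain ending at $\eta$ is the maximal chain whose final embedding is $\eta$ and whose chain id is lexicographically least. - $v_k$ is a descent if $l_k>l_{k+1}$. - A descent is strong if $v_{k-1}\ne v_{k+1}mn$ for all minimal $m,n$. Skipped intervals. $C(v_i,v_j)=\{v_{i+1},\dots,v_{j-1}\}$. A nonempty $C(v_i,v_j)$ is skipped if $C\setminus C(v_i,v_j)\subseteq C'$ for some earlier maximal chain $C'$. It is minimally skipped if it contains properly no skipped interval. Principal factors. Let $w$ be non-flat and let $p$ be a prefix of $w$ ($|p|\le|w|$, $p(k)\le w(k)$ for $k\le|p|$) with an embedding into $w$ other than the prefix one, such that no longer prefix of $w$ having $p$ as prefix has more than one embedding in $w$. - The principal index of $p$ is the least $k$ with $w(k)>p(k)$ ($p(k)=\hat0$ for $k>|p|$) and $w(k)$ reducible. - $p$ is a principal factor of $w$ if reducing $w(k)$ leaves only the prefix embedding of $p$.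
   Formalization: In "strong descent", v_{k-1}=v_{k+1}mn is read for words as embedded along the chain (literal reading fails: mmn→mm→m); the order of F is assumed generated by its cover relations (automatic if F is finite); first admissible chains are also allowed for flat v_j. *)

theory Defs
  imports Main "HOL-Library.Option_ord" "HOL-Library.Disjoint_Sets"
begin

definition covers :: "('b \<Rightarrow> 'b \<Rightarrow> bool) \<Rightarrow> 'b \<Rightarrow> 'b \<Rightarrow> bool" where
  "covers le x y \<longleftrightarrow> le y x \<and> y \<noteq> x \<and> (\<forall>z. le y z \<and> le z x \<longrightarrow> z = y \<or> z = x)"

definition minimal :: "'a::order \<Rightarrow> bool" where
  "minimal x \<longleftrightarrow> (\<forall>y. \<not> y < x)"

definition hasse_path :: "'a::order set \<Rightarrow> 'a list \<Rightarrow> bool" where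
  "hasse_path P xs \<longleftrightarrow> xs \<noteq> [] \<and> set xs \<subseteq> P \<and> distinct xs \<and>
     successively (\<lambda>x y. covers (\<le>) x y \<or> covers (\<le>) y x) xs"

definition hasse_tree :: "'a::order set \<Rightarrow> bool" where
  "hasse_tree P \<longleftrightarrow> (\<forall>x\<in>P. \<forall>y\<in>P. \<exists>!xs. hasse_path P xs \<and> hd xs = x \<and> last xs = y)"

definition rooted_tree :: "'a::order set \<Rightarrow> bool" where
  "rooted_tree P \<longleftrightarrow> (\<exists>!r. r \<in> P \<and> (\<forall>x\<in>P. \<not> x < r)) \<and> hasse_tree P"

text \<open>The last two conjuncts follow from the first one when the forest is finite. They are needed
  because infinite forests are admitted: the order has to be the one drawn by the Hasse diagram
  (the reflexive-transitive closure of the covering relation), and every non-minimal element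
  has to cover a unique element.\<close>

definition rooted_forest :: "'a::order itself \<Rightarrow> bool" where
  "rooted_forest _ \<longleftrightarrow>
     (\<exists>\<P>. partition_on (UNIV :: 'a set) \<P> \<and>
          (\<forall>P\<in>\<P>. \<forall>Q\<in>\<P>. P \<noteq> Q \<longrightarrow> (\<forall>x\<in>P. \<forall>y\<in>Q. \<not> x \<le> y)) \<and>
          (\<forall>P\<in>\<P>. rooted_tree P)) \<and>
     (\<forall>x y :: 'a. x \<le> y \<longleftrightarrow> (covers (\<le>))\<^sup>*\<^sup>* y x) \<and>
     (\<forall>x :: 'a. \<not> minimal x \<longrightarrow> (\<exists>!y. covers (\<le>) x y))"

text \<open>Words are lists, and all positions are counted from 0, so every index (chain ids and
  principal indices alike) is one less than in the usual 1-based convention.\<close>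

definition word_le :: "'a::order list \<Rightarrow> 'a list \<Rightarrow> bool" where
  "word_le u w \<longleftrightarrow>
     (\<exists>i. i + length u \<le> length w \<and> (\<forall>j<length u. u ! j \<le> w ! (i + j)))"

definition flat :: "'a::order list \<Rightarrow> bool" where
  "flat w \<longleftrightarrow> (\<exists>m. minimal m \<and> set w \<subseteq> {m})"

text \<open>The alphabet with a new bottom element adjoined is the type \<^typ>\<open>'a option\<close>, with
  \<^term>\<open>None\<close> as the bottom.\<close>

definition embedding :: "'a::order list \<Rightarrow> 'a list \<Rightarrow> 'a option list \<Rightarrow> bool" where
  "embedding v w \<eta> \<longleftrightarrow> length \<eta> = length w \<and>
     (\<exists>a b. \<eta> = replicate a None @ map Some v @ replicate b None) \<and>
     (\<forall>k<length w. \<eta> ! k \<le> Some (w ! k))"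

definition prefix_embedding :: "'a::order list \<Rightarrow> 'a list \<Rightarrow> 'a option list" where
  "prefix_embedding p w = map Some p @ replicate (length w - length p) None"

definition embedding_reducible :: "'a::order list \<Rightarrow> 'a option list \<Rightarrow> nat \<Rightarrow> bool" where
  "embedding_reducible v \<eta> k \<longleftrightarrow> k < length \<eta> \<and>
     (\<exists>x. \<eta> ! k = Some x \<and>
        (\<not> minimal x \<or>
         (\<forall>j<k. \<eta> ! j = None) \<or>
         (\<not> flat v \<and> (\<forall>j. k < j \<and> j < length \<eta> \<longrightarrow> \<eta> ! j = None))))"

definition word_reducible :: "'a::order list \<Rightarrow> nat \<Rightarrow> bool" where
  "word_reducible w k \<longleftrightarrow> k < length w \<and>
     (\<not> minimal (w ! k) \<or> k = 0 \<or> (k = length w - 1 \<and> \<not> flat w))"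

definition reduce_at :: "'a::order option list \<Rightarrow> nat \<Rightarrow> 'a option list" where
  "reduce_at \<eta> k = \<eta>[k := (THE y. covers (\<le>) (\<eta> ! k) y)]"

text \<open>A chain is the list of its words from top to bottom.\<close>

definition maximal_chain :: "'a::order list \<Rightarrow> 'a list \<Rightarrow> 'a list list \<Rightarrow> bool" where
  "maximal_chain u w vs \<longleftrightarrow>
     vs \<noteq> [] \<and> hd vs = w \<and> last vs = u \<and> successively (covers word_le) vs"

definition chain_embedding :: "'a::order list \<Rightarrow> nat list \<Rightarrow> nat \<Rightarrow> 'a option list" where
  "chain_embedding w ls k = foldl reduce_at (map Some w) (take k ls)"

text \<open>The entry \<open>ls ! k\<close> is the position reduced in the step from \<open>vs ! k\<close> to \<open>vs ! (k + 1)\<close>.\<close>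

definition chain_id :: "'a::order list list \<Rightarrow> nat list \<Rightarrow> bool" where
  "chain_id vs ls \<longleftrightarrow> length vs = Suc (length ls) \<and>
     (\<forall>k\<le>length ls. embedding (vs ! k) (hd vs) (chain_embedding (hd vs) ls k)) \<and>
     (\<forall>k<length ls. embedding_reducible (vs ! k) (chain_embedding (hd vs) ls k) (ls ! k))"

definition earlier_chain :: "'a::order list list \<Rightarrow> 'a list list \<Rightarrow> bool" where
  "earlier_chain vs' vs \<longleftrightarrow>
     (\<exists>ls' ls. chain_id vs' ls' \<and> chain_id vs ls \<and> (ls', ls) \<in> lexord less_than)"

text \<open>The word \<open>v\<close> may be flat, as in \<open>aba \<rightarrow> ab \<rightarrow> a\<close>, which ends at the prefix embedding of \<open>a\<close>.
  Some embeddings of flat words are the end of no chain; then no chain is first admissible.\<close>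

definition first_admissible_chain ::
  "'a::order list \<Rightarrow> 'a list \<Rightarrow> 'a option list \<Rightarrow> 'a list list \<Rightarrow> bool" where
  "first_admissible_chain v w \<eta> vs \<longleftrightarrow>
     maximal_chain v w vs \<and>
     (\<exists>ls. chain_id vs ls \<and> chain_embedding w ls (length ls) = \<eta> \<and>
        (\<forall>vs' ls'. maximal_chain v w vs' \<and> chain_id vs' ls' \<and>
             chain_embedding w ls' (length ls') = \<eta> \<longrightarrow>
           ls' = ls \<or> (ls, ls') \<in> lexord less_than))"

definition offset :: "'a option list \<Rightarrow> nat" where
  "offset \<eta> = length (takeWhile (\<lambda>x. x = None) \<eta>)"

definition descent :: "nat list \<Rightarrow> nat \<Rightarrow> bool" where
  "descent ls k \<longleftrightarrow> 0 < k \<and> k < length ls \<and> ls ! (k - 1) > ls ! k"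

text \<open>In the condition \<open>v\<^bsub>k-1\<^esub> \<noteq> v\<^bsub>k+1\<^esub> m n\<close> the words stand for their embeddings along the
  chain: \<open>v\<^bsub>k-1\<^esub> = v\<^bsub>k+1\<^esub> m n\<close> says that \<open>v\<^bsub>k+1\<^esub>\<close> is what remains of \<open>v\<^bsub>k-1\<^esub>\<close> after its last two
  letters are removed. Given a descent, this differs from equality of words only when \<open>v\<^bsub>k\<^esub>\<close>
  is flat: in the chain \<open>mmn \<rightarrow> mm \<rightarrow> m\<close> with chain id 2, 0 the last and then the first letter
  are removed. There \<open>mm\<close> counts as a strong descent, although \<open>mmn\<close> and \<open>m \<cdot> mn\<close> are equal
  as words.\<close>

definition strong_descent :: "'a::order list list \<Rightarrow> nat list \<Rightarrow> nat \<Rightarrow> bool" where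
  "strong_descent vs ls k \<longleftrightarrow> descent ls k \<and>
     (\<forall>m n. minimal m \<and> minimal n \<longrightarrow>
        \<not> (vs ! (k - 1) = vs ! (k + 1) @ [m, n] \<and>
           offset (chain_embedding (hd vs) ls (k - 1)) =
           offset (chain_embedding (hd vs) ls (k + 1))))"

definition chain_interval :: "'a list list \<Rightarrow> nat \<Rightarrow> nat \<Rightarrow> 'a list set" where
  "chain_interval vs i j = {vs ! k | k. i < k \<and> k < j}"

definition skipped :: "'a::order list \<Rightarrow> 'a list \<Rightarrow> 'a list list \<Rightarrow> nat \<Rightarrow> nat \<Rightarrow> bool" where
  "skipped u w vs i j \<longleftrightarrow> chain_interval vs i j \<noteq> {} \<and>
     (\<exists>vs'. maximal_chain u w vs' \<and> earlier_chain vs' vs \<and>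
        set vs - chain_interval vs i j \<subseteq> set vs')"

definition minimally_skipped ::
  "'a::order list \<Rightarrow> 'a list \<Rightarrow> 'a list list \<Rightarrow> nat \<Rightarrow> nat \<Rightarrow> bool" where
  "minimally_skipped u w vs i j \<longleftrightarrow> skipped u w vs i j \<and>
     (\<forall>a b. a < b \<and> b < length vs \<and> chain_interval vs a b \<subset> chain_interval vs i j \<longrightarrow>
        \<not> skipped u w vs a b)"

text \<open>Letterwise order on a common initial segment, not literal equality of the letters.\<close>

definition word_prefix :: "'a::order list \<Rightarrow> 'a list \<Rightarrow> bool" where
  "word_prefix p w \<longleftrightarrow> length p \<le> length w \<and> (\<forall>k<length p. p ! k \<le> w ! k)"

definition principal_index :: "'a::order list \<Rightarrow> 'a list \<Rightarrow> nat" where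
  "principal_index p w =
     (LEAST k. word_reducible w k \<and>
        (if k < length p then Some (p ! k) else None) < Some (w ! k))"

definition principal_factor :: "'a::order list \<Rightarrow> 'a list \<Rightarrow> bool" where
  "principal_factor p w \<longleftrightarrow> \<not> flat w \<and> word_prefix p w \<and>
     (\<exists>\<eta>. embedding p w \<eta> \<and> \<eta> \<noteq> prefix_embedding p w) \<and>
     (\<forall>q. word_prefix q w \<and> word_prefix p q \<and> length p < length q \<longrightarrow>
        \<not> (\<exists>\<eta> \<eta>'. embedding q w \<eta> \<and> embedding q w \<eta>' \<and> \<eta> \<noteq> \<eta>')) \<and>
     {\<eta>. embedding p w \<eta> \<and>
         list_all2 (\<le>) \<eta> (reduce_at (map Some w) (principal_index p w))}
       = {prefix_embedding p w}"

end

theory Submission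
  imports Defs
begin

text \<open>A step of a chain acts on a state, the current word together with its offset in the top word,
  and it is determined by the position reduced. Since every word above the bottom of an interval can
  be continued down to it, the lexicographically first chain is found greedily. Hence an interval is
  skipped iff some step in it is bad: a smaller position could have been reduced while staying above
  the bottom of the interval. In a minimally skipped interval only the first step is bad, and it
  becomes harmless when the last step is dropped.

  A strong descent can be swapped, so it is a bad step. If there is none, the chain first reduces
  letters from left to right and then removes letters from the right end. So it ends at the prefix
  embedding, its first position is the principal index, and the absence of other bad steps says that
  neither a longer prefix in the top word nor the bottom word in the reduced top word embeds a second
  time. Conversely, a second
  embedding of a principal factor avoids the first letter, and reducing that letter is the earlier
  alternative.\<close>

definition down :: "'a::order \<Rightarrow> 'a" where
  "down x = (THE y. covers (\<le>) x y)"

lemma rtranclp_first_step: "R\<^sup>*\<^sup>* x y \<Longrightarrow> x \<noteq> y \<Longrightarrow> \<exists>z. R x z \<and> R\<^sup>*\<^sup>* z y"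
  by (erule converse_rtranclpE) auto

lemma successively_imp_rtranclp:
  "successively R xs \<Longrightarrow> xs \<noteq> [] \<Longrightarrow> R\<^sup>*\<^sup>* (hd xs) (last xs)"
  by (induction xs rule: induct_list012) (auto intro: converse_rtranclp_into_rtranclp)

locale rooted_forest_order =
  fixes T :: "'a::order itself"
  assumes rooted_forest: "rooted_forest TYPE('a)"
begin

lemmas rooted_forest_conjuncts = rooted_forest[unfolded rooted_forest_def]

lemma le_iff_covers: "x \<le> y \<longleftrightarrow> (covers (\<le>))\<^sup>*\<^sup>* y x" for x y :: 'a
  using rooted_forest_conjuncts[THEN conjunct2, THEN conjunct1] by (elim allE)

lemma ex1_covers: "\<not> minimal x \<Longrightarrow> \<exists>!y. covers (\<le>) x y" for x :: 'a
  using rooted_forest_conjuncts[THEN conjunct2, THEN conjunct2] by (elim allE impE)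

lemma covers_imp_less: "covers (\<le>) x y \<Longrightarrow> y < x" for x y :: 'a
  unfolding covers_def by auto

lemma covers_down: "\<not> minimal x \<Longrightarrow> covers (\<le>) x (down x)" for x :: 'a
  unfolding down_def by (rule theI'[OF ex1_covers])

lemma covers_eq_down: "covers (\<le>) x y \<longleftrightarrow> \<not> minimal x \<and> y = down x" for x y :: 'a
proof
  assume c: "covers (\<le>) x y"
  then have n: "\<not> minimal x"
    using covers_imp_less[OF c] unfolding minimal_def by auto
  then show "\<not> minimal x \<and> y = down x"
    using c covers_down[OF n] ex1_covers[OF n] by auto
qed (simp add: covers_down)

lemma down_less: "\<not> minimal x \<Longrightarrow> down x < x" for x :: 'a
  using covers_down covers_imp_less by blast

lemma le_down: "y < x \<Longrightarrow> y \<le> down x" for x y :: 'a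
proof -
  assume "y < x"
  then have "(covers (\<le>))\<^sup>*\<^sup>* x y" "x \<noteq> y" using le_iff_covers[of y x] by auto
  then obtain z where "covers (\<le>) x z" "(covers (\<le>))\<^sup>*\<^sup>* z y"
    using rtranclp_first_step[of "covers (\<le>)" x y] by auto
  then show ?thesis using covers_eq_down[of x z] le_iff_covers[of y z] by simp
qed

lemma minimal_le: "minimal x \<Longrightarrow> y \<le> x \<Longrightarrow> y = x" for x y :: 'a
  unfolding minimal_def using le_neq_trans by blast

lemma lower_set_chain: "x \<le> z \<Longrightarrow> y \<le> z \<Longrightarrow> x \<le> y \<or> y \<le> x" for x y z :: 'a
proof -
  assume "x \<le> z" "y \<le> z"
  then have "(covers (\<le>))\<^sup>*\<^sup>* z x" "(covers (\<le>))\<^sup>*\<^sup>* z y"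
    using le_iff_covers[of x z] le_iff_covers[of y z] by simp_all
  then show ?thesis
  proof (induction rule: converse_rtranclp_induct)
    case base
    then show ?case using le_iff_covers[of y x] by simp
  next
    case (step a b)
    show ?case
    proof (cases "a = y")
      case True
      have "(covers (\<le>))\<^sup>*\<^sup>* a x" using step(1,2) by (rule converse_rtranclp_into_rtranclp)
      then show ?thesis using True le_iff_covers[of x a] by simp
    next
      case False
      then obtain c where "covers (\<le>) a c" "(covers (\<le>))\<^sup>*\<^sup>* c y"
        using step.prems rtranclp_first_step[of "covers (\<le>)" a y] by auto
      moreover have "b = c" using calculation(1) step(1) covers_eq_down[of a] by simp
      ultimately show ?thesis using step.IH by simp
    qed
  qed
qed

text \<open>Up-down turns are impossible on a simple path, because an element covers only one other.\<close>

lemma path_to_minimal_descends: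
  fixes xs :: "'a list"
  assumes "hasse_path P xs" "minimal (last xs)"
  shows "successively (covers (\<le>)) xs"
  using assms
proof (induction xs)
  case Nil
  then show ?case by (simp add: hasse_path_def)
next
  case (Cons x xs)
  show ?case
  proof (cases xs)
    case Nil
    then show ?thesis by simp
  next
    case (Cons y ys)
    have "hasse_path P xs" "minimal (last xs)"
      using Cons.prems Cons by (auto simp: hasse_path_def)
    then have IH: "successively (covers (\<le>)) xs" using Cons.IH by blast
    have "\<not> covers (\<le>) y x"
    proof
      assume c: "covers (\<le>) y x"
      show False
      proof (cases ys)
        case Nil
        then show ?thesis using c Cons.prems Cons covers_eq_down by auto
      next
        case (Cons z zs)
        then have "covers (\<le>) y z" using IH \<open>xs = y # ys\<close> by auto
        then have "x = z" using c covers_eq_down by auto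
        then show ?thesis using Cons.prems \<open>xs = y # ys\<close> Cons by (auto simp: hasse_path_def)
      qed
    qed
    then show ?thesis using Cons.prems Cons IH by (auto simp: hasse_path_def)
  qed
qed

lemma minimal_below: "\<exists>m. minimal m \<and> m \<le> x" for x :: 'a
proof -
  obtain \<P> where P: "partition_on (UNIV :: 'a set) \<P>"
    "\<forall>P\<in>\<P>. \<forall>Q\<in>\<P>. P \<noteq> Q \<longrightarrow> (\<forall>x\<in>P. \<forall>y\<in>Q. \<not> x \<le> y)" "\<forall>P\<in>\<P>. rooted_tree P"
    using rooted_forest_conjuncts[THEN conjunct1] by blast
  have cover: "\<exists>P\<in>\<P>. y \<in> P" for y using P(1) unfolding partition_on_def by blast
  obtain P where p: "P \<in> \<P>" "x \<in> P" using cover by blast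
  then obtain r where r: "r \<in> P" "\<forall>x\<in>P. \<not> x < r" using P(3) unfolding rooted_tree_def by blast
  have m: "minimal r" unfolding minimal_def
  proof (intro allI notI)
    fix y assume y: "y < r"
    obtain Q where "Q \<in> \<P>" "y \<in> Q" using cover by blast
    then have "P = Q" using P(2) p(1) r(1) y less_imp_le[OF y] by blast
    then show False using \<open>y \<in> Q\<close> r(2) y by blast
  qed
  obtain xs where "hasse_path P xs" "hd xs = x" "last xs = r"
    using bspec[OF P(3) p(1)] p(2) r(1) unfolding rooted_tree_def hasse_tree_def by blast
  then have "(covers (\<le>))\<^sup>*\<^sup>* x r"
    using path_to_minimal_descends[of P xs] successively_imp_rtranclp[of "covers (\<le>)" xs] m
    unfolding hasse_path_def by simp
  then show ?thesis using m le_iff_covers[of r x] by auto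
qed

lemma finite_atMost: "finite {..x}" for x :: 'a
proof -
  obtain m where m: "minimal m" "m \<le> x" using minimal_below by blast
  then have "(covers (\<le>))\<^sup>*\<^sup>* x m" using le_iff_covers[of m x] by simp
  then show ?thesis
  proof (induction rule: converse_rtranclp_induct)
    case base
    have "{..m} = {m}" using minimal_le[OF m(1)] by blast
    then show ?case by simp
  next
    case (step y z)
    then have "z = down y" using covers_eq_down[of y z] by simp
    have "{..y} \<subseteq> insert y {..z}"
    proof
      fix a assume "a \<in> {..y}"
      then have "a = y \<or> a < y" using le_neq_trans[of a y] by auto
      then show "a \<in> insert y {..z}" using le_down[of a y] \<open>z = down y\<close> by auto
    qed
    then show ?case by (rule finite_subset) (simp add: step.IH)
  qed
qed

lemma card_atMost_mono: "x < y \<Longrightarrow> card {..x} < card {..y}" for x y :: 'a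
proof (rule psubset_card_mono[OF finite_atMost])
  assume "x < y"
  then have "y \<notin> {..x}" "{..x} \<subseteq> {..y}" by auto
  then show "{..x} \<subset> {..y}" by blast
qed

lemma option_cover: "(THE z. covers (\<le>) (Some x) z) = (if minimal x then None else Some (down x))"
  for x :: 'a
proof (rule the_equality)
  show "covers (\<le>) (Some x) (if minimal x then None else Some (down x))"
  proof (cases "minimal x")
    case True
    then show ?thesis unfolding covers_def
      by (auto simp: less_eq_option_def split: option.splits dest: minimal_le)
  next
    case False
    then show ?thesis using covers_down[of x] unfolding covers_def
      by (auto simp: less_eq_option_def split: option.splits)
  qed
next
  fix z assume z: "covers (\<le>) (Some x) z"
  show "z = (if minimal x then None else Some (down x))"
  proof (cases z)
    case None
    have "minimal x"
    proof (rule ccontr)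
      assume "\<not> minimal x"
      then have "down x < x" using down_less by blast
      then show False using z None unfolding covers_def
        by (auto dest: spec[of _ "Some (down x)"])
    qed
    then show ?thesis using None by simp
  next
    case (Some y)
    have "covers (\<le>) x y" unfolding covers_def
    proof (intro conjI allI impI)
      show "y \<le> x" "y \<noteq> x" using z Some unfolding covers_def by auto
      fix c assume "y \<le> c \<and> c \<le> x"
      then show "c = y \<or> c = x" using z Some unfolding covers_def
        by (auto dest: spec[of _ "Some c"])
    qed
    then show ?thesis using Some covers_eq_down by auto
  qed
qed

end

definition le_at :: "nat \<Rightarrow> 'a::order list \<Rightarrow> 'a list \<Rightarrow> bool" where
  "le_at e u w \<longleftrightarrow> e + length u \<le> length w \<and> (\<forall>j<length u. u ! j \<le> w ! (e + j))"

lemma word_le_iff: "word_le u w \<longleftrightarrow> (\<exists>e. le_at e u w)"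
  unfolding word_le_def le_at_def by blast

lemma word_prefix_iff: "word_prefix p w \<longleftrightarrow> le_at 0 p w"
  unfolding word_prefix_def le_at_def by simp

lemma le_at_length: "le_at e u w \<Longrightarrow> e + length u \<le> length w"
  unfolding le_at_def by simp

lemma le_at_nth: "le_at e u w \<Longrightarrow> j < length u \<Longrightarrow> u ! j \<le> w ! (e + j)"
  unfolding le_at_def by simp

lemma le_at_refl: "le_at 0 u u"
  unfolding le_at_def by simp

lemma le_at_trans: "le_at e u v \<Longrightarrow> le_at f v w \<Longrightarrow> le_at (f + e) u w"
  unfolding le_at_def
proof (intro conjI allI impI; elim conjE)
  fix j
  assume *: "\<forall>j<length u. u ! j \<le> v ! (e + j)" "\<forall>j<length v. v ! j \<le> w ! (f + j)"
    "j < length u" "e + length u \<le> length v"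
  then have "u ! j \<le> v ! (e + j)" "v ! (e + j) \<le> w ! (f + (e + j))" by auto
  then show "u ! j \<le> w ! (f + e + j)" by (simp add: ac_simps order_trans)
qed simp

lemma le_at_antisym: "le_at 0 u v \<Longrightarrow> le_at 0 v u \<Longrightarrow> u = v"
  unfolding le_at_def by (intro nth_equalityI order_antisym) auto

lemma word_le_refl: "word_le u u"
  using le_at_refl word_le_iff by blast

lemma word_le_trans: "word_le u v \<Longrightarrow> word_le v w \<Longrightarrow> word_le u w"
  unfolding word_le_iff using le_at_trans by blast

lemma word_le_length: "word_le u w \<Longrightarrow> length u \<le> length w"
  unfolding word_le_def by auto

lemma word_le_eq_length: "word_le u w \<Longrightarrow> length u = length w \<Longrightarrow> le_at 0 u w"
  unfolding word_le_iff le_at_def by auto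

lemma word_le_antisym: "word_le u v \<Longrightarrow> word_le v u \<Longrightarrow> u = v"
  by (metis word_le_eq_length word_le_length le_at_antisym le_antisym)

lemma word_le_nonempty: "word_le u w \<Longrightarrow> u \<noteq> [] \<Longrightarrow> w \<noteq> []"
  by (auto dest: word_le_length)

definition red :: "'a::order list \<Rightarrow> nat \<Rightarrow> 'a list" where
  "red v k = (if minimal (v ! k) then (if k = 0 then tl v else butlast v)
              else v[k := down (v ! k)])"

definition shift :: "'a::order list \<Rightarrow> nat \<Rightarrow> nat" where
  "shift v k = (if k = 0 \<and> minimal (v ! 0) then 1 else 0)"

lemma shift_pos [simp]: "0 < k \<Longrightarrow> shift v k = 0"
  unfolding shift_def by simp

lemma word_reducible_cases:
  assumes "word_reducible v k"
  obtains (letter) "k < length v" "\<not> minimal (v ! k)" "red v k = v[k := down (v ! k)]" "shift v k = 0"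
  | (first) "k = 0" "minimal (v ! 0)" "red v k = tl v" "shift v k = 1" "v \<noteq> []"
  | (last) "k = length v - 1" "0 < k" "k < length v" "minimal (v ! k)" "\<not> flat v" "red v k = butlast v" "shift v k = 0"
proof (cases "minimal (v ! k)")
  case False
  then have "shift v k = 0" unfolding shift_def by (cases "k = 0") auto
  then show thesis using False assms letter unfolding word_reducible_def red_def by auto
next
  case True
  show thesis
  proof (cases "k = 0")
    case k: True
    then show ?thesis using True assms first unfolding word_reducible_def red_def shift_def by auto
  next
    case k: False
    then have "k = length v - 1" "\<not> flat v" "k < length v"
      using True assms unfolding word_reducible_def by auto
    then show ?thesis using True k last unfolding red_def shift_def by auto
  qed
qed

lemma word_reducible_zero: "v \<noteq> [] \<Longrightarrow> word_reducible v 0"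
  unfolding word_reducible_def by simp

context rooted_forest_order
begin

lemma le_at_red:
  fixes v :: "'a list"
  assumes "word_reducible v k"
  shows "le_at (shift v k) (red v k) v"
  using assms
proof (cases rule: word_reducible_cases)
  case letter
  then show ?thesis using down_less[of "v ! k"] by (auto simp: le_at_def nth_list_update)
qed (auto simp: le_at_def nth_tl nth_butlast)

lemma word_le_red: "word_reducible v k \<Longrightarrow> word_le (red v k) v" for v :: "'a list"
  using le_at_red word_le_iff by blast

lemma red_neq:
  fixes v :: "'a list"
  assumes "word_reducible v k"
  shows "red v k \<noteq> v"
  using assms
proof (cases rule: word_reducible_cases)
  case letter
  then show ?thesis by (metis down_less less_irrefl nth_list_update_eq)
next
  case last
  then have "length (butlast v) \<noteq> length v" by auto
  then show ?thesis using last by metis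
next
  case first
  then have "length (tl v) \<noteq> length v" by (cases v) auto
  then show ?thesis using first by metis
qed

lemma constant_if_decreasing:
  fixes v :: "'a list"
  assumes "minimal (v ! 0)" "\<And>t. Suc t < length v \<Longrightarrow> v ! Suc t \<le> v ! t" "t < length v"
  shows "v ! t = v ! 0"
  using assms(3)
proof (induction t)
  case (Suc t)
  then show ?case using assms(2)[of t] minimal_le[OF assms(1)] by auto
qed simp

lemma constant_if_increasing:
  fixes v :: "'a list"
  assumes "minimal (v ! n)" "\<And>t. t < n \<Longrightarrow> v ! t \<le> v ! Suc t" "t \<le> n"
  shows "v ! t = v ! n"
  using assms(3)
proof (induction t rule: inc_induct)
  case (step t)
  then show ?case using assms(2)[of t] minimal_le[OF assms(1)] by auto
qed simp

lemma flatI: "minimal m \<Longrightarrow> (\<And>t. t < length v \<Longrightarrow> v ! t = m) \<Longrightarrow> flat v" for v :: "'a list"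
  unfolding flat_def by (intro exI[of _ m]) (auto simp: in_set_conv_nth)

lemma le_at_01: "le_at e u v \<Longrightarrow> length v \<le> Suc (length u) \<Longrightarrow> e = 0 \<or> e = 1"
  unfolding le_at_def by auto

lemma covers_red:
  fixes v :: "'a list"
  assumes "word_reducible v k"
  shows "covers word_le v (red v k)"
  unfolding covers_def
proof (intro conjI allI impI)
  show "word_le (red v k) v" using word_le_red assms by blast
  show "red v k \<noteq> v" using red_neq assms by blast
  fix z assume z: "word_le (red v k) z \<and> word_le z v"
  then have len: "length (red v k) \<le> length z" "length z \<le> length v" using word_le_length by auto
  show "z = red v k \<or> z = v"
    using assms
  proof (cases rule: word_reducible_cases)
    case letter
    then have l: "length z = length v" "length z = length (red v k)" using len by auto
    then have le: "le_at 0 (red v k) z" "le_at 0 z v" using z word_le_eq_length by metis+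
    have "z ! t = v ! t" if "t < length v" "t \<noteq> k" for t
      using le that l letter unfolding le_at_def by (metis add_0 nth_list_update_neq order_antisym)
    moreover have "z ! k = v ! k \<or> z ! k = down (v ! k)"
      using le letter l covers_down[of "v ! k"] unfolding le_at_def covers_def
      by (metis add_0 nth_list_update_eq)
    ultimately show ?thesis using l letter
      by (metis list_update_id length_list_update nth_equalityI nth_list_update_eq nth_list_update_neq)
  next
    case first
    obtain e f where e: "le_at e (tl v) z" and f: "le_at f z v"
      using z first word_le_iff by metis
    have eq: "length z = length (tl v) \<or> length z = length v" using len first by (cases v) auto
    then show ?thesis
    proof
      assume lz: "length z = length (tl v)"
      then have e0: "e = 0" using le_at_length[OF e] by auto
      have f01: "f = 0 \<or> f = 1" using le_at_01[OF f] lz by auto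
      then show ?thesis
      proof
        assume f0: "f = 0"
        have a: "v ! Suc t \<le> z ! t" "z ! t \<le> v ! t" if "Suc t < length v" for t
          using le_at_nth[OF e, of t] le_at_nth[OF f, of t] e0 f0 that lz by (auto simp: nth_tl)
        then have c: "v ! t = v ! 0" if "t < length v" for t
          using constant_if_decreasing first that order_trans by blast
        have "z ! t = v ! Suc t" if "Suc t < length v" for t
          using a[OF that] c[OF that] c[of t] that by auto
        then have "z = tl v" using lz by (intro nth_equalityI) (auto simp: nth_tl)
        then show ?thesis using first by simp
      next
        assume f1: "f = 1"
        have "z = tl v" using lz
        proof (intro nth_equalityI)
          fix t assume t: "t < length z"
          then show "z ! t = tl v ! t"
            using le_at_nth[OF e, of t] le_at_nth[OF f, of t] e0 f1 lz by (auto simp: nth_tl)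
        qed
        then show ?thesis using first by simp
      qed
    next
      assume lz: "length z = length v"
      then have f0: "f = 0" using le_at_length[OF f] by auto
      have e01: "e = 0 \<or> e = 1" using le_at_01[OF e] lz by auto
      have z0: "z ! 0 = v ! 0" using le_at_nth[OF f, of 0] f0 first minimal_le lz by auto
      from e01 have "z = v"
      proof
        assume e0: "e = 0"
        have a: "v ! Suc t \<le> z ! t" "z ! t \<le> v ! t" if "Suc t < length v" for t
          using le_at_nth[OF e, of t] le_at_nth[OF f, of t] e0 f0 that lz by (auto simp: nth_tl)
        then have c: "v ! t = v ! 0" if "t < length v" for t
          using constant_if_decreasing first that order_trans by blast
        show ?thesis using lz
        proof (intro nth_equalityI)
          fix t assume t: "t < length z"
          then have "z ! t \<le> v ! 0" using le_at_nth[OF f, of t] f0 c[of t] lz by auto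
          then show "z ! t = v ! t" using minimal_le first c[of t] t lz by auto
        qed
      next
        assume e1: "e = 1"
        show ?thesis using lz
        proof (intro nth_equalityI)
          fix t assume t: "t < length z"
          show "z ! t = v ! t"
          proof (cases t)
            case 0
            then show ?thesis using z0 by simp
          next
            case (Suc s)
            then show ?thesis
              using le_at_nth[OF e, of s] le_at_nth[OF f, of t] e1 f0 lz t by (auto simp: nth_tl)
          qed
        qed
      qed
      then show ?thesis by simp
    qed
  next
    case last
    obtain e f where e: "le_at e (butlast v) z" and f: "le_at f z v"
      using z last word_le_iff by metis
    have flat: False if "\<And>t. t < k \<Longrightarrow> v ! t \<le> v ! Suc t"
    proof -
      have "v ! t = v ! k" if "t < length v" for t
        using constant_if_increasing[of v k t] last that \<open>\<And>t. t < k \<Longrightarrow> v ! t \<le> v ! Suc t\<close> by auto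
      then show False using last flatI by blast
    qed
    have eq: "length z = length (butlast v) \<or> length z = length v" using len last by auto
    then show ?thesis
    proof
      assume lz: "length z = length (butlast v)"
      then have e0: "e = 0" using le_at_length[OF e] by auto
      have "f = 0 \<or> f = 1" using le_at_01[OF f] lz by auto
      moreover have "f \<noteq> 1"
      proof
        assume f1: "f = 1"
        have "v ! t \<le> v ! Suc t" if "t < k" for t
          using le_at_nth[OF e, of t] le_at_nth[OF f, of t] e0 f1 lz last that
          by (auto simp: nth_butlast intro: order_trans)
        then show False using flat by blast
      qed
      ultimately have f0: "f = 0" by simp
      have "z = butlast v" using lz
      proof (intro nth_equalityI)
        fix t assume t: "t < length z"
        then show "z ! t = butlast v ! t"
          using le_at_nth[OF e, of t] le_at_nth[OF f, of t] e0 f0 lz by (auto simp: nth_butlast)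
      qed
      then show ?thesis using last by simp
    next
      assume lz: "length z = length v"
      then have f0: "f = 0" using le_at_length[OF f] by auto
      have "e = 0 \<or> e = 1" using le_at_01[OF e] lz by auto
      moreover have "e \<noteq> 1"
      proof
        assume e1: "e = 1"
        have "v ! t \<le> v ! Suc t" if "t < k" for t
          using le_at_nth[OF e, of t] le_at_nth[OF f, of "Suc t"] e1 f0 lz last that
          by (auto simp: nth_butlast intro: order_trans)
        then show False using flat by blast
      qed
      ultimately have e0: "e = 0" by simp
      have "z = v" using lz
      proof (intro nth_equalityI)
        fix t assume t: "t < length z"
        show "z ! t = v ! t"
        proof (cases "t = k")
          case True
          then show ?thesis using le_at_nth[OF f, of t] f0 last minimal_le t by auto
        next
          case False
          then show ?thesis
            using le_at_nth[OF e, of t] le_at_nth[OF f, of t] e0 f0 lz t last by (auto simp: nth_butlast)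
        qed
      qed
      then show ?thesis by simp
    qed
  qed
qed

lemma red_inj:
  fixes v :: "'a list"
  assumes k: "word_reducible v k" and k': "word_reducible v k'" and eq: "red v k = red v k'"
  shows "k = k'"
proof -
  have no: False if "word_reducible v 0" "minimal (v ! 0)" "minimal (v ! l)" "l = length v - 1"
    "tl v = butlast v" "\<not> flat v" for l
  proof -
    have "v ! Suc t = v ! t" if "Suc t < length v" for t
      using that \<open>tl v = butlast v\<close> by (metis length_butlast length_tl less_diff_conv nth_butlast nth_tl Suc_eq_plus1)
    then have "v ! t = v ! 0" if "t < length v" for t
      using constant_if_decreasing[of v t] \<open>minimal (v ! 0)\<close> that by auto
    then show False using flatI \<open>\<not> flat v\<close> \<open>minimal (v ! 0)\<close> by blast
  qed
  have len: "length (red v k) = length (red v k')" using eq by simp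
  from k show ?thesis
  proof (cases rule: word_reducible_cases)
    case l: letter
    from k' show ?thesis
    proof (cases rule: word_reducible_cases)
      case letter
      then show ?thesis using l eq by (metis down_less less_irrefl nth_list_update_eq nth_list_update_neq)
    qed (use l len in auto)
  next
    case f: first
    from k' show ?thesis
    proof (cases rule: word_reducible_cases)
      case letter
      then have "length (tl v) = length v" using f len by simp
      then show ?thesis using f by (cases v) auto
    next
      case last
      then show ?thesis using no[of k'] f eq k by auto
    qed (use f in auto)
  next
    case l: last
    from k' show ?thesis
    proof (cases rule: word_reducible_cases)
      case letter
      then show ?thesis using l len by auto
    next
      case first
      then show ?thesis using no[of k] l eq k' by auto
    qed (use l in auto)
  qed
qed

lemma exists_red_above:
  fixes u :: "'a list"
  assumes "word_le u x" "u \<noteq> x"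
  shows "\<exists>t. word_reducible x t \<and> word_le u (red x t)"
proof -
  obtain e where e: "le_at e u x" using assms word_le_iff by blast
  show ?thesis
  proof (cases "\<exists>t<length x. \<not> minimal (x ! t) \<and> (e \<le> t \<and> t < e + length u \<longrightarrow> u ! (t - e) \<noteq> x ! t)")
    case True
    then obtain t where t: "t < length x" "\<not> minimal (x ! t)"
      "e \<le> t \<and> t < e + length u \<Longrightarrow> u ! (t - e) \<noteq> x ! t" by blast
    have "le_at e u (x[t := down (x ! t)])" unfolding le_at_def
    proof (intro conjI allI impI)
      show "e + length u \<le> length (x[t := down (x ! t)])" using e le_at_length by auto
      fix j assume j: "j < length u"
      show "u ! j \<le> x[t := down (x ! t)] ! (e + j)"
      proof (cases "t = e + j")
        case True
        then have "u ! j < x ! t" using t(3) j le_at_nth[OF e j] by auto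
        then show ?thesis using le_down t(1) True by auto
      next
        case False
        then show ?thesis using le_at_nth[OF e j] by auto
      qed
    qed
    then have "word_le u (red x t)" using t(2) word_le_iff[of u "red x t"] by (auto simp: red_def)
    moreover have "word_reducible x t" using t by (simp add: word_reducible_def)
    ultimately show ?thesis by blast
  next
    case False
    then have all: "minimal (x ! t) \<or> (e \<le> t \<and> t < e + length u \<and> u ! (t - e) = x ! t)"
      if "t < length x" for t using that by blast
    have same: "u ! t = x ! (e + t)" if "t < length u" for t
      using all[of "e + t"] that le_at_nth[OF e that] le_at_length[OF e]
        minimal_le[of "x ! (e + t)" "u ! t"] by auto
    have "length u < length x"
    proof (rule ccontr)
      assume "\<not> length u < length x"
      then have "e = 0" "length u = length x" using le_at_length[OF e] by auto
      then show False using same assms(2) by (auto intro: nth_equalityI)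
    qed
    then have ne: "x \<noteq> []" by auto
    show ?thesis
    proof (cases "e = 0")
      case False
      then have "minimal (x ! 0)" using all[of 0] ne by auto
      moreover have "le_at (e - 1) u (tl x)"
        using e False unfolding le_at_def by (auto simp: nth_tl)
      ultimately have "word_le u (red x 0)" using word_le_iff[of u "red x 0"] by (auto simp: red_def)
      then show ?thesis using word_reducible_zero[OF ne] by blast
    next
      case True
      define k where "k = length x - 1"
      have k: "k < length x" "minimal (x ! k)" "length u \<le> k"
        using all[of "length x - 1"] True \<open>length u < length x\<close> ne unfolding k_def by auto
      show ?thesis
      proof (cases "flat x")
        case True
        then obtain m where m: "minimal m" "\<And>t. t < length x \<Longrightarrow> x ! t = m"
          unfolding flat_def by (metis nth_mem singletonD subsetD)
        have "le_at 0 u (tl x)"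
          using same \<open>e = 0\<close> \<open>length u < length x\<close> m unfolding le_at_def by (auto simp: nth_tl)
        moreover have "x ! 0 = m" using m(2)[of 0] ne by simp
        ultimately have "word_le u (red x 0)"
          using m(1) word_le_iff[of u "red x 0"] by (auto simp: red_def)
        then show ?thesis using word_reducible_zero[OF ne] by blast
      next
        case False
        have "le_at 0 u (red x k)"
          using e k \<open>e = 0\<close> \<open>length u < length x\<close> unfolding le_at_def red_def
          by (auto simp: nth_tl nth_butlast)
        moreover have "word_reducible x k" using k False unfolding word_reducible_def k_def by simp
        ultimately show ?thesis using word_le_iff by blast
      qed
    qed
  qed
qed

definition rank :: "'a list \<Rightarrow> nat" where
  "rank v = (\<Sum>x\<leftarrow>v. card {..x})"

lemma rank_red:
  assumes "word_reducible v k"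
  shows "rank (red v k) < rank v"
proof -
  have pos: "0 < card {..x}" for x :: 'a using finite_atMost[of x] by (auto simp: card_gt_0_iff)
  from assms show ?thesis
  proof (cases rule: word_reducible_cases)
    case letter
    have "rank v = rank (take k v @ v ! k # drop (Suc k) v)"
      using id_take_nth_drop[OF letter(1)] by simp
    moreover have "rank (red v k) = rank (take k v @ down (v ! k) # drop (Suc k) v)"
      using letter by (simp add: upd_conv_take_nth_drop)
    ultimately show ?thesis
      unfolding rank_def using card_atMost_mono[OF down_less[OF letter(2)]] by simp
  next
    case first
    then show ?thesis using pos by (cases v) (auto simp: rank_def)
  next
    case last
    then have "v \<noteq> []" by auto
    then have "rank v = rank (butlast v @ [List.last v])" by simp
    then show ?thesis using last pos[of "List.last v"] by (simp add: rank_def)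
  qed
qed

end

text \<open>A state \<open>(a, v)\<close> is the word \<open>v\<close> placed at offset \<open>a\<close> of an ambient word.\<close>

definition emb :: "nat \<Rightarrow> nat \<times> 'a list \<Rightarrow> 'a option list" where
  "emb N s = replicate (fst s) None @ map Some (snd s) @ replicate (N - fst s - length (snd s)) None"

definition fits :: "nat \<Rightarrow> nat \<times> 'a list \<Rightarrow> bool" where
  "fits N s \<longleftrightarrow> fst s + length (snd s) \<le> N"

definition enabled :: "nat \<times> 'a::order list \<Rightarrow> nat \<Rightarrow> bool" where
  "enabled s l \<longleftrightarrow> fst s \<le> l \<and> word_reducible (snd s) (l - fst s)"

definition step :: "nat \<times> 'a::order list \<Rightarrow> nat \<Rightarrow> nat \<times> 'a list" where
  "step s l = (fst s + shift (snd s) (l - fst s), red (snd s) (l - fst s))"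

primrec valid :: "nat \<times> 'a::order list \<Rightarrow> nat list \<Rightarrow> bool" where
  "valid s [] \<longleftrightarrow> True"
| "valid s (l # ls) \<longleftrightarrow> enabled s l \<and> valid (step s l) ls"

primrec trace :: "nat \<times> 'a::order list \<Rightarrow> nat list \<Rightarrow> 'a list list" where
  "trace s [] = [snd s]"
| "trace s (l # ls) = snd s # trace (step s l) ls"

abbreviation run :: "nat \<times> 'a::order list \<Rightarrow> nat list \<Rightarrow> nat \<times> 'a list" where
  "run \<equiv> foldl step"

lemma length_emb: "fits N s \<Longrightarrow> length (emb N s) = N"
  unfolding emb_def fits_def by simp

lemma nth_emb:
  "k < N \<Longrightarrow> fits N s \<Longrightarrow> emb N s ! k =
    (if fst s \<le> k \<and> k < fst s + length (snd s) then Some (snd s ! (k - fst s)) else None)"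
  unfolding emb_def fits_def by (auto simp: nth_append)

lemma word_of_emb: "map the (filter (\<lambda>x. x \<noteq> None) (emb N s)) = snd s"
  unfolding emb_def by (simp add: filter_map comp_def)

lemma offset_emb: "snd s \<noteq> [] \<Longrightarrow> offset (emb N s) = fst s"
proof -
  assume "snd s \<noteq> []"
  then obtain x xs where "snd s = x # xs" by (cases "snd s") auto
  then show ?thesis unfolding emb_def offset_def by (simp add: takeWhile_append)
qed

lemma emb_inj: "emb N s = emb N t \<Longrightarrow> snd s \<noteq> [] \<Longrightarrow> s = t"
  by (metis offset_emb prod_eqI word_of_emb)

lemma emb_self: "emb (length w) (0, w) = map Some w"
  unfolding emb_def by simp

lemma prefix_embedding_eq: "prefix_embedding p w = emb (length w) (0, p)"
  unfolding emb_def prefix_embedding_def by simp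

lemma le_at_fits: "le_at e v w \<Longrightarrow> fits (length w) (e, v)"
  unfolding fits_def using le_at_length by fastforce

lemma embedding_iff: "embedding v w \<eta> \<longleftrightarrow> (\<exists>e. \<eta> = emb (length w) (e, v) \<and> le_at e v w)"
proof
  assume emb: "embedding v w \<eta>"
  then obtain a b where \<eta>: "\<eta> = replicate a None @ map Some v @ replicate b None"
    unfolding embedding_def by blast
  have len: "length \<eta> = length w" and le: "\<And>k. k < length w \<Longrightarrow> \<eta> ! k \<le> Some (w ! k)"
    using emb unfolding embedding_def by auto
  have "\<eta> = emb (length w) (a, v)" unfolding emb_def using \<eta> len by auto
  moreover have "le_at a v w" unfolding le_at_def
  proof (intro conjI allI impI)
    show "a + length v \<le> length w" using \<eta> len by auto
    fix j assume "j < length v"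
    then have "\<eta> ! (a + j) = Some (v ! j)" "a + j < length w"
      using len unfolding \<eta> by (auto simp: nth_append)
    then show "v ! j \<le> w ! (a + j)" using le[of "a + j"] by simp
  qed
  ultimately show "\<exists>e. \<eta> = emb (length w) (e, v) \<and> le_at e v w" by blast
next
  assume "\<exists>e. \<eta> = emb (length w) (e, v) \<and> le_at e v w"
  then obtain e where \<eta>: "\<eta> = emb (length w) (e, v)" and e: "le_at e v w" by blast
  have f: "fits (length w) (e, v)" using e le_at_fits by blast
  show "embedding v w \<eta>" unfolding embedding_def
  proof (intro conjI allI impI)
    show "length \<eta> = length w" using \<eta> f length_emb by blast
    show "\<exists>a b. \<eta> = replicate a None @ map Some v @ replicate b None"
      unfolding \<eta> emb_def by auto
    fix k assume k: "k < length w"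
    show "\<eta> ! k \<le> Some (w ! k)"
    proof (cases "e \<le> k \<and> k < e + length v")
      case True
      then have "v ! (k - e) \<le> w ! k" using le_at_nth[OF e, of "k - e"] by auto
      then show ?thesis using True nth_emb[OF k f] \<eta> by simp
    qed (use nth_emb[OF k f] \<eta> in auto)
  qed
qed

lemma valid_append: "valid s (xs @ ys) \<longleftrightarrow> valid s xs \<and> valid (run s xs) ys"
  by (induction xs arbitrary: s) auto

lemma length_trace [simp]: "length (trace s ls) = Suc (length ls)"
  by (induction ls arbitrary: s) auto

lemma trace_nonempty [simp]: "trace s ls \<noteq> []"
  by (cases ls) auto

lemma hd_trace [simp]: "hd (trace s ls) = snd s"
  by (cases ls) auto

lemma last_trace [simp]: "last (trace s ls) = snd (run s ls)"
  by (induction ls arbitrary: s) auto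

lemma nth_trace: "k \<le> length ls \<Longrightarrow> trace s ls ! k = snd (run s (take k ls))"
proof (induction ls arbitrary: s k)
  case (Cons l ls)
  then show ?case by (cases k) auto
qed simp

lemma trace_append: "trace s (xs @ ys) = butlast (trace s xs) @ trace (run s xs) ys"
  by (induction xs arbitrary: s) auto

lemma drop_trace: "k \<le> length ls \<Longrightarrow> drop k (trace s ls) = trace (run s (take k ls)) (drop k ls)"
proof (induction ls arbitrary: s k)
  case (Cons l ls)
  then show ?case by (cases k) auto
qed simp

lemma take_trace: "k \<le> length ls \<Longrightarrow> take (Suc k) (trace s ls) = trace s (take k ls)"
proof (induction ls arbitrary: s k)
  case (Cons l ls)
  then show ?case by (cases k) auto
qed simp

text \<open>Positions are measured in the ambient word, so moving a run to another offset translates its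
  chain id.\<close>

lemma valid_translate:
  assumes "valid (a, v) ls"
  shows "valid (b, v) (map (\<lambda>l. l - a + b) ls)"
    and "trace (b, v) (map (\<lambda>l. l - a + b) ls) = trace (a, v) ls"
    and "run (b, v) (map (\<lambda>l. l - a + b) ls) = (fst (run (a, v) ls) - a + b, snd (run (a, v) ls))"
proof -
  have "valid (b, v) (map (\<lambda>l. l - a + b) ls) \<and>
    trace (b, v) (map (\<lambda>l. l - a + b) ls) = trace (a, v) ls \<and>
    run (b, v) (map (\<lambda>l. l - a + b) ls) = (fst (run (a, v) ls) - a + b, snd (run (a, v) ls)) \<and>
    a \<le> fst (run (a, v) ls) \<and> (\<forall>l\<in>set ls. a \<le> l)"
    using assms
  proof (induction ls arbitrary: a b v)
    case Nil
    then show ?case by simp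
  next
    case (Cons l ls)
    define d where "d = shift v (l - a)"
    have l: "a \<le> l" "word_reducible v (l - a)" using Cons.prems by (auto simp: enabled_def)
    have s: "step (a, v) l = (a + d, red v (l - a))" "step (b, v) (l - a + b) = (b + d, red v (l - a))"
      by (auto simp: step_def d_def)
    have v: "valid (a + d, red v (l - a)) ls" using Cons.prems s by simp
    note IH = Cons.IH[OF v, of "b + d"]
    have m: "map (\<lambda>l. l - a + b) ls = map (\<lambda>l. l - (a + d) + (b + d)) ls"
      using IH by auto
    show ?case using IH l s m by (auto simp: enabled_def simp del: map_eq_conv)
  qed
  then show "valid (b, v) (map (\<lambda>l. l - a + b) ls)"
    and "trace (b, v) (map (\<lambda>l. l - a + b) ls) = trace (a, v) ls"
    and "run (b, v) (map (\<lambda>l. l - a + b) ls) = (fst (run (a, v) ls) - a + b, snd (run (a, v) ls))" by auto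
qed

context rooted_forest_order
begin

lemma run_le_at:
  fixes s :: "nat \<times> 'a list"
  shows "valid s ls \<Longrightarrow> fst s \<le> fst (run s ls) \<and>
    le_at (fst (run s ls) - fst s) (snd (run s ls)) (snd s)"
proof (induction ls arbitrary: s)
  case Nil
  then show ?case using le_at_refl by simp
next
  case (Cons l ls)
  define k where "k = l - fst s"
  have k: "word_reducible (snd s) k" using Cons.prems by (auto simp: enabled_def k_def)
  have st: "fst (step s l) = fst s + shift (snd s) k" "snd (step s l) = red (snd s) k"
    by (auto simp: step_def k_def)
  have IH: "fst (step s l) \<le> fst (run s (l # ls))"
    "le_at (fst (run s (l # ls)) - fst (step s l)) (snd (run s (l # ls))) (snd (step s l))"
    using Cons by auto
  have "le_at (shift (snd s) k + (fst (run s (l # ls)) - fst (step s l))) (snd (run s (l # ls))) (snd s)"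
    using le_at_trans[OF IH(2)] le_at_red[OF k] st by simp
  then show ?case using IH(1) st by (simp add: algebra_simps)
qed

lemma run_word_le: "valid s ls \<Longrightarrow> word_le (snd (run s ls)) (snd s)" for s :: "nat \<times> 'a list"
  using run_le_at word_le_iff by blast

lemma run_fits: "valid s ls \<Longrightarrow> fits N s \<Longrightarrow> fits N (run s ls)" for s :: "nat \<times> 'a list"
  using run_le_at[of s ls] le_at_length unfolding fits_def by fastforce

lemma step_covers: "enabled s l \<Longrightarrow> covers word_le (snd s) (snd (step s l))"
  for s :: "nat \<times> 'a list"
  using covers_red unfolding enabled_def step_def by auto

lemma step_inj:
  "enabled s l \<Longrightarrow> enabled s l' \<Longrightarrow> snd (step s l) = snd (step s l') \<Longrightarrow> l = l'"
  for s :: "nat \<times> 'a list"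
  using red_inj[of "snd s" "l - fst s" "l' - fst s"] unfolding enabled_def step_def by auto

lemma trace_successively:
  "valid s ls \<Longrightarrow> successively (covers word_le) (trace s ls)" for s :: "nat \<times> 'a list"
proof (induction ls arbitrary: s)
  case (Cons l ls)
  then have "successively (covers word_le) (trace (step s l) ls)" "covers word_le (snd s) (snd (step s l))"
    using step_covers by auto
  then show ?case by (simp add: successively_Cons)
qed simp

lemma trace_maximal_chain:
  "valid s ls \<Longrightarrow> maximal_chain (snd (run s ls)) (snd s) (trace s ls)" for s :: "nat \<times> 'a list"
  unfolding maximal_chain_def using trace_successively by auto

lemma exists_run_to:
  fixes s :: "nat \<times> 'a list"
  assumes "word_le u (snd s)"
  shows "\<exists>ls. valid s ls \<and> snd (run s ls) = u"
  using assms
proof (induction "rank (snd s)" arbitrary: s rule: less_induct)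
  case less
  show ?case
  proof (cases "u = snd s")
    case True
    then show ?thesis by (intro exI[of _ "[]"]) simp
  next
    case False
    then obtain t where t: "word_reducible (snd s) t" "word_le u (red (snd s) t)"
      using exists_red_above less.prems by blast
    define s' where "s' = step s (fst s + t)"
    have "snd s' = red (snd s) t" by (simp add: s'_def step_def)
    then obtain ls where "valid s' ls" "snd (run s' ls) = u"
      using less.hyps[of s'] rank_red[OF t(1)] t(2) by auto
    then show ?thesis
      using t(1) by (intro exI[of _ "(fst s + t) # ls"]) (auto simp: enabled_def s'_def)
  qed
qed

lemma reduce_at_emb:
  fixes s :: "nat \<times> 'a list"
  assumes "enabled s l" "fits N s"
  shows "reduce_at (emb N s) l = emb N (step s l)"
proof -
  obtain a v where s: "s = (a, v)" by fastforce
  define k where "k = l - a"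
  have l: "l = a + k" and k: "word_reducible v k" using assms(1) by (auto simp: enabled_def s k_def)
  have kv: "k < length v" using k by (auto simp: word_reducible_def)
  have fit: "a + length v \<le> N" using assms(2) by (simp add: fits_def s)
  have "valid s [l]" using assms(1) by simp
  then have f': "fits N (step s l)" using run_fits[of s "[l]" N] assms(2) by simp
  have st: "step s l = (a + shift v k, red v k)" by (simp add: step_def s l)
  have lN: "l < N" using l kv fit by simp
  have at_l: "emb N s ! l = Some (v ! k)" using nth_emb[OF lN assms(2)] l kv by (simp add: s)
  have r: "reduce_at (emb N s) l = (emb N s)[l := (if minimal (v ! k) then None else Some (down (v ! k)))]"
    unfolding reduce_at_def at_l option_cover ..
  show ?thesis unfolding r
  proof (rule nth_equalityI)
    show "length ((emb N s)[l := (if minimal (v ! k) then None else Some (down (v ! k)))]) = length (emb N (step s l))"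
      using length_emb[OF f'] length_emb[OF assms(2)] by simp
    fix i assume "i < length ((emb N s)[l := (if minimal (v ! k) then None else Some (down (v ! k)))])"
    then have i: "i < N" using length_emb[OF assms(2)] by simp
    have n1: "emb N s ! i = (if a \<le> i \<and> i < a + length v then Some (v ! (i - a)) else None)"
      using nth_emb[OF i assms(2)] by (simp add: s)
    have n2: "emb N (step s l) ! i =
      (if a + shift v k \<le> i \<and> i < a + shift v k + length (red v k)
       then Some (red v k ! (i - (a + shift v k))) else None)"
      using nth_emb[OF i f'] by (simp only: st fst_conv snd_conv)
    have n0: "(emb N s)[l := y] ! i = (if i = l then y else emb N s ! i)" for y
      using i length_emb[OF assms(2)] by (simp add: nth_list_update)
    show "(emb N s)[l := (if minimal (v ! k) then None else Some (down (v ! k)))] ! i = emb N (step s l) ! i"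
      using k
    proof (cases rule: word_reducible_cases)
      case letter
      then show ?thesis unfolding n0 n2 n1 using kv l by (auto simp: nth_list_update)
    next
      case first
      then show ?thesis unfolding n0 n2 n1 using kv l by (auto simp: nth_tl Suc_diff_Suc)
    next
      case last
      then show ?thesis unfolding n0 n2 n1 using kv l by (auto simp: nth_butlast)
    qed
  qed
qed

lemma embedding_reducible_emb:
  fixes s :: "nat \<times> 'a list"
  assumes fit: "fits N s" and ne: "snd s \<noteq> []"
  shows "embedding_reducible (snd s) (emb N s) l \<longleftrightarrow> enabled s l"
proof -
  obtain a v where s: "s = (a, v)" by fastforce
  have N: "a + length v \<le> N" "v \<noteq> []" using assms by (auto simp: fits_def s)
  have nth: "emb N s ! k = (if a \<le> k \<and> k < a + length v then Some (v ! (k - a)) else None)"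
    if "k < N" for k using nth_emb[OF that fit] by (simp add: s)
  show ?thesis
  proof (cases "a \<le> l \<and> l < a + length v")
    case False
    have "\<not> enabled s l"
    proof
      assume "enabled s l"
      then have "a \<le> l" "l - a < length v" by (simp_all add: enabled_def word_reducible_def s)
      then show False using False by linarith
    qed
    moreover have "\<not> embedding_reducible (snd s) (emb N s) l"
      using False nth[of l] length_emb[OF fit] unfolding embedding_reducible_def by auto
    ultimately show ?thesis by simp
  next
    case True
    then have lN: "l < N" and at_l: "emb N s ! l = Some (v ! (l - a))" using N nth[of l] by auto
    have first: "(\<forall>j<l. emb N s ! j = None) \<longleftrightarrow> l = a"
    proof
      assume *: "\<forall>j<l. emb N s ! j = None"
      show "l = a"
      proof (rule ccontr)
        assume "l \<noteq> a"
        then have "a < l" using True by simp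
        then show False using *[rule_format, of a] nth[of a] N lN by simp
      qed
    next
      assume "l = a"
      then show "\<forall>j<l. emb N s ! j = None" using nth lN by auto
    qed
    have last: "(\<forall>j. l < j \<and> j < N \<longrightarrow> emb N s ! j = None) \<longleftrightarrow> l - a = length v - 1"
    proof
      assume *: "\<forall>j. l < j \<and> j < N \<longrightarrow> emb N s ! j = None"
      have "\<not> Suc l < a + length v"
      proof
        assume "Suc l < a + length v"
        then show False using *[rule_format, of "Suc l"] nth[of "Suc l"] N True by auto
      qed
      then show "l - a = length v - 1" using True by auto
    next
      assume "l - a = length v - 1"
      then show "\<forall>j. l < j \<and> j < N \<longrightarrow> emb N s ! j = None" using nth True by auto
    qed
    show ?thesis
      unfolding embedding_reducible_def length_emb[OF fit] first last at_l enabled_def word_reducible_def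
      using True lN by (auto simp: s)
  qed
qed

lemma foldl_reduce_at:
  fixes s :: "nat \<times> 'a list"
  shows "valid s ls \<Longrightarrow> fits N s \<Longrightarrow> foldl reduce_at (emb N s) ls = emb N (run s ls)"
proof (induction ls arbitrary: s)
  case (Cons l ls)
  have "fits N (step s l)" using run_fits[of s "[l]" N] Cons.prems by simp
  then show ?case using Cons reduce_at_emb[of s l N] by simp
qed simp

lemma valid_take: "valid s ls \<Longrightarrow> valid s (take k ls)"
  by (metis append_take_drop_id valid_append)

lemma valid_drop: "valid s ls \<Longrightarrow> valid (run s (take k ls)) (drop k ls)"
  by (metis append_take_drop_id valid_append)

lemma chain_embedding_eq:
  fixes w :: "'a list"
  assumes "valid (0, w) (take k ls)"
  shows "chain_embedding w ls k = emb (length w) (run (0, w) (take k ls))"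
  unfolding chain_embedding_def emb_self[symmetric]
  using assms by (intro foldl_reduce_at) (auto simp: fits_def)

lemma chain_id_imp_trace:
  fixes vs :: "'a list list"
  assumes id: "chain_id vs ls" and ne: "\<forall>v\<in>set vs. v \<noteq> []"
  shows "valid (0, hd vs) ls" and "vs = trace (0, hd vs) ls"
proof -
  define w where "w = hd vs"
  have len: "length vs = Suc (length ls)" using id by (simp add: chain_id_def)
  then have "vs \<noteq> []" by auto
  have *: "valid (0, w) (take k ls) \<and> vs ! k = snd (run (0, w) (take k ls))" if "k \<le> length ls" for k
    using that
  proof (induction k)
    case 0
    then show ?case using \<open>vs \<noteq> []\<close> by (simp add: w_def hd_conv_nth)
  next
    case (Suc k)
    define s where "s = run (0, w) (take k ls)"
    have IH: "valid (0, w) (take k ls)" "vs ! k = snd s" using Suc by (auto simp: s_def)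
    have k: "k < length ls" using Suc by simp
    have tk: "take (Suc k) ls = take k ls @ [ls ! k]" using k by (simp add: take_Suc_conv_app_nth)
    have fit: "fits (length w) s" unfolding s_def using run_fits[OF IH(1)] by (simp add: fits_def)
    have "embedding_reducible (vs ! k) (chain_embedding w ls k) (ls ! k)"
      using id k unfolding chain_id_def w_def by blast
    moreover have "vs ! k \<noteq> []" using ne len k by auto
    ultimately have "enabled s (ls ! k)"
      using embedding_reducible_emb[OF fit] IH chain_embedding_eq[OF IH(1)] by (simp add: s_def)
    then have v: "valid (0, w) (take (Suc k) ls)" using IH(1) tk by (simp add: valid_append s_def)
    have "embedding (vs ! Suc k) w (chain_embedding w ls (Suc k))"
      using id Suc.prems unfolding chain_id_def w_def by blast
    then obtain e where "emb (length w) (run (0, w) (take (Suc k) ls)) = emb (length w) (e, vs ! Suc k)"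
      using chain_embedding_eq[OF v] embedding_iff by metis
    then have "snd (run (0, w) (take (Suc k) ls)) = vs ! Suc k" using word_of_emb by (metis snd_conv)
    then show ?case using v by simp
  qed
  show "valid (0, hd vs) ls" using *[of "length ls"] by (simp add: w_def)
  show "vs = trace (0, hd vs) ls"
    using * len by (intro nth_equalityI) (auto simp: nth_trace w_def)
qed

lemma run_take_nonempty:
  fixes s :: "nat \<times> 'a list"
  assumes "valid s ls" "snd (run s ls) \<noteq> []"
  shows "snd (run s (take k ls)) \<noteq> []"
proof -
  have "run s ls = run (run s (take k ls)) (drop k ls)" by (metis append_take_drop_id foldl_append)
  then show ?thesis
    using run_word_le[OF valid_drop[OF assms(1), of k]] assms(2) word_le_nonempty by metis
qed

lemma chain_id_trace:
  fixes w :: "'a list"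
  assumes v: "valid (0, w) ls" and ne: "snd (run (0, w) ls) \<noteq> []"
  shows "chain_id (trace (0, w) ls) ls"
  unfolding chain_id_def
proof (intro conjI allI impI)
  show "length (trace (0, w) ls) = Suc (length ls)" by simp
next
  fix k assume k: "k \<le> length ls"
  note vk = valid_take[OF v, of k]
  have "le_at (fst (run (0, w) (take k ls))) (snd (run (0, w) (take k ls))) w"
    using run_le_at[OF vk] by simp
  then show "embedding (trace (0, w) ls ! k) (hd (trace (0, w) ls)) (chain_embedding (hd (trace (0, w) ls)) ls k)"
    unfolding hd_trace snd_conv chain_embedding_eq[OF vk] embedding_iff nth_trace[OF k]
    by (intro exI[of _ "fst (run (0, w) (take k ls))"]) simp
next
  fix k assume k: "k < length ls"
  define s where "s = run (0, w) (take k ls)"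
  note vk = valid_take[OF v, of k]
  have "enabled s (ls ! k)"
    using valid_drop[OF v, of k] k by (simp add: s_def Cons_nth_drop_Suc[symmetric])
  moreover have "fits (length w) s" unfolding s_def using run_fits[OF vk] by (simp add: fits_def)
  moreover have "snd s \<noteq> []" using run_take_nonempty[OF v ne] by (simp add: s_def)
  ultimately show "embedding_reducible (trace (0, w) ls ! k) (chain_embedding (hd (trace (0, w) ls)) ls k) (ls ! k)"
    unfolding hd_trace snd_conv chain_embedding_eq[OF vk] nth_trace[OF less_imp_le[OF k]] s_def[symmetric]
    using embedding_reducible_emb by blast
qed

lemma valid_trace_inj:
  fixes s :: "nat \<times> 'a list"
  assumes "valid s ls" "valid s ls'" "trace s ls = trace s ls'"
  shows "ls = ls'"
  using assms
proof (induction ls arbitrary: s ls')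
  case Nil
  then have "length (trace s ls') = 1" by (metis length_trace list.size(3) One_nat_def)
  then show ?case by simp
next
  case (Cons l ls)
  then have "length (trace s ls') = Suc (Suc (length ls))" by (metis length_trace length_Cons)
  then obtain l' ls'' where ls': "ls' = l' # ls''" by (cases ls') auto
  have eq: "trace (step s l) ls = trace (step s l') ls''" using Cons.prems ls' by simp
  then have "snd (step s l) = snd (step s l')" by (metis hd_trace)
  then have l: "l = l'" using step_inj[of s l l'] Cons.prems ls' by simp
  have "ls = ls''" using Cons.IH[of "step s l" ls''] Cons.prems eq ls' l by simp
  then show ?case using ls' l by simp
qed

lemma successively_covers_word_le:
  fixes vs :: "'a list list"
  shows "vs \<noteq> [] \<Longrightarrow> successively (covers word_le) vs \<Longrightarrow> word_le (last vs) (hd vs)"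
proof (induction vs rule: induct_list012)
  case (3 a b zs)
  then show ?case using word_le_trans by (auto simp: covers_def)
qed (auto simp: word_le_refl)

lemma maximal_chain_word_le:
  fixes u :: "'a list"
  assumes "maximal_chain u w vs" "v \<in> set vs"
  shows "word_le u v"
proof -
  obtain xs ys where vs: "vs = xs @ v # ys" using split_list[OF assms(2)] by blast
  then have "successively (covers word_le) (v # ys)" "last (v # ys) = u"
    using assms(1) by (auto simp: maximal_chain_def successively_append_iff)
  then show ?thesis using successively_covers_word_le[of "v # ys"] by auto
qed

lemma run_strict:
  fixes s :: "nat \<times> 'a list"
  assumes "valid s ls" "ls \<noteq> []"
  shows "snd (run s ls) \<noteq> snd s"
proof
  assume eq: "snd (run s ls) = snd s"
  obtain l ls' where ls: "ls = l # ls'" using assms(2) by (cases ls) auto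
  have c: "covers word_le (snd s) (snd (step s l))" using assms ls step_covers by auto
  have "word_le (snd s) (snd (step s l))"
    using run_word_le[of "step s l" ls'] assms(1) eq ls by simp
  then show False using c word_le_antisym unfolding covers_def by blast
qed

lemma lexord_first_difference:
  fixes s :: "nat \<times> 'a list"
  assumes v: "valid s ls" and v': "valid s ls'" and eq: "snd (run s ls) = snd (run s ls')"
    and lex: "(ls', ls) \<in> lexord less_than"
  obtains d where "d < length ls" "d < length ls'" "take d ls' = take d ls" "ls' ! d < ls ! d"
proof -
  have "ls \<noteq> ls' @ a # xs" for a xs
  proof
    assume "ls = ls' @ a # xs"
    then show False using run_strict[of "run s ls'" "a # xs"] v eq by (simp add: valid_append)
  qed
  then obtain xs a b ys zs where "a < b" "ls' = xs @ a # ys" "ls = xs @ b # zs"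
    using lex unfolding lexord_def by auto
  then show thesis using that[of "length xs"] by simp
qed

lemma earlier_run:
  fixes s :: "nat \<times> 'a list"
  assumes v: "valid s ls" and d: "d < length ls" and l: "l < ls ! d" "enabled (run s (take d ls)) l"
    and le: "word_le x (snd (step (run s (take d ls)) l))"
  obtains mid where "valid s (take d ls @ l # mid)" "snd (run s (take d ls @ l # mid)) = x"
    "\<And>tail. (take d ls @ l # mid @ tail, ls) \<in> lexord less_than"
proof -
  obtain mid where mid: "valid (step (run s (take d ls)) l) mid"
    "snd (run (step (run s (take d ls)) l) mid) = x" using exists_run_to[OF le] by blast
  show thesis
  proof
    show "valid s (take d ls @ l # mid)" using mid(1) l(2) valid_take[OF v] by (simp add: valid_append)
    show "snd (run s (take d ls @ l # mid)) = x" using mid(2) by simp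
    fix tail
    have "ls = take d ls @ ls ! d # drop (Suc d) ls" using d by (rule id_take_nth_drop)
    then show "(take d ls @ l # mid @ tail, ls) \<in> lexord less_than"
      using l(1) unfolding lexord_def by (auto intro!: exI[of _ "take d ls"])
  qed
qed

lemma le_at_mono_red:
  fixes x y :: "'a list"
  assumes "le_at 0 y x" "k < length y" "y ! k = x ! k" "minimal (y ! k) \<Longrightarrow> k = 0"
  shows "word_le (red y k) (red x k)"
proof (cases "minimal (y ! k)")
  case True
  then have k: "k = 0" using assms(4) by blast
  then have "red y k = tl y" "red x k = tl x" using True assms(3) by (auto simp: red_def)
  moreover have "le_at 0 (tl y) (tl x)" using assms(1) unfolding le_at_def by (auto simp: nth_tl)
  ultimately show ?thesis using word_le_iff by metis
next
  case False
  then have "red y k = y[k := down (y ! k)]" "red x k = x[k := down (y ! k)]"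
    using assms(3) by (auto simp: red_def)
  moreover have "le_at 0 (y[k := down (y ! k)]) (x[k := down (y ! k)])"
    using assms(1,2) unfolding le_at_def by (auto simp: nth_list_update)
  ultimately show ?thesis using word_le_iff by metis
qed

abbreviation drops :: "'a list \<Rightarrow> 'a list \<Rightarrow> nat \<Rightarrow> bool" where
  "drops p x k \<equiv> word_reducible x k \<and> (if k < length p then Some (p ! k) else None) < Some (x ! k)"

lemma word_le_red_zero:
  fixes p x :: "'a list"
  assumes "le_at e p x" "0 < e"
  shows "word_le p (red x 0)"
proof (cases "minimal (x ! 0)")
  case True
  have "le_at (e - 1) p (tl x)" using assms unfolding le_at_def by (auto simp: nth_tl)
  then show ?thesis using True word_le_iff by (metis red_def)
next
  case False
  have "le_at e p (x[0 := down (x ! 0)])" using assms unfolding le_at_def by auto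
  then show ?thesis using False word_le_iff by (metis red_def)
qed

lemma list_all2_emb_iff:
  fixes p x :: "'a list"
  assumes "p \<noteq> []" "fits N (e, p)" "fits N (d, x)"
  shows "list_all2 (\<le>) (emb N (e, p)) (emb N (d, x)) \<longleftrightarrow> d \<le> e \<and> le_at (e - d) p x"
proof
  assume la: "list_all2 (\<le>) (emb N (e, p)) (emb N (d, x))"
  have at: "d \<le> e + j \<and> e + j < d + length x \<and> p ! j \<le> x ! (e + j - d)" if "j < length p" for j
  proof -
    have k: "e + j < N" using that assms(2) by (simp add: fits_def)
    have "emb N (e, p) ! (e + j) \<le> emb N (d, x) ! (e + j)"
      using list_all2_nthD[OF la, of "e + j"] k length_emb[OF assms(2)] by simp
    then show ?thesis using nth_emb[OF k assms(2)] nth_emb[OF k assms(3)] that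
      by (auto split: if_splits)
  qed
  have de: "d \<le> e" using at[of 0] assms(1) by simp
  moreover have "e - d + length p \<le> length x" using at[of "length p - 1"] assms(1) de
    by (cases p) auto
  ultimately show "d \<le> e \<and> le_at (e - d) p x" using at unfolding le_at_def by auto
next
  assume *: "d \<le> e \<and> le_at (e - d) p x"
  show "list_all2 (\<le>) (emb N (e, p)) (emb N (d, x))"
  proof (rule list_all2_all_nthI)
    show "length (emb N (e, p)) = length (emb N (d, x))"
      using length_emb[OF assms(2)] length_emb[OF assms(3)] by simp
    fix k assume "k < length (emb N (e, p))"
    then have k: "k < N" using length_emb[OF assms(2)] by simp
    show "emb N (e, p) ! k \<le> emb N (d, x) ! k"
    proof (cases "e \<le> k \<and> k < e + length p")
      case True
      have "p ! (k - e) \<le> x ! (e - d + (k - e))" using * True by (intro le_at_nth) auto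
      moreover have "e - d + (k - e) = k - d" using * True by simp
      moreover have "d \<le> k" "k < d + length x" using * True le_at_length[of "e - d" p x] by auto
      ultimately show ?thesis
        using nth_emb[OF k assms(2)] nth_emb[OF k assms(3)] True by simp
    next
      case False
      then show ?thesis using nth_emb[OF k assms(2)] by auto
    qed
  qed
qed

lemma only_prefix_embedding_iff:
  fixes p x :: "'a list"
  assumes p: "p \<noteq> []" and k: "word_reducible x k"
  shows "{\<eta>. embedding p x \<eta> \<and> list_all2 (\<le>) \<eta> (reduce_at (map Some x) k)} = {prefix_embedding p x}
    \<longleftrightarrow> shift x k = 0 \<and> le_at 0 p (red x k) \<and> (\<forall>e. le_at e p (red x k) \<longrightarrow> e = 0)"
    (is "?S = _ \<longleftrightarrow> _")
proof -
  define d where "d = shift x k"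
  define y where "y = red x k"
  define N where "N = length x"
  have yx: "le_at d y x" using le_at_red[OF k] by (simp add: d_def y_def)
  have fy: "fits N (d, y)" using le_at_fits[OF yx] by (simp add: N_def)
  have "reduce_at (emb N (0, x)) k = emb N (step (0, x) k)"
    using k by (intro reduce_at_emb) (auto simp: enabled_def fits_def N_def)
  then have r: "reduce_at (map Some x) k = emb N (d, y)"
    using emb_self[of x] by (simp add: step_def d_def y_def N_def)
  have mem: "emb N (e, p) \<in> ?S \<longleftrightarrow> d \<le> e \<and> le_at (e - d) p y" for e
  proof
    assume "emb N (e, p) \<in> ?S"
    then obtain e' where e': "emb N (e, p) = emb N (e', p)" "le_at e' p x"
      "list_all2 (\<le>) (emb N (e, p)) (emb N (d, y))"
      unfolding r embedding_iff N_def by auto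
    then have ee: "e = e'" using emb_inj[OF e'(1)] p by simp
    have "fits N (e', p)" using le_at_fits[OF e'(2)] by (simp add: N_def)
    then show "d \<le> e \<and> le_at (e - d) p y" using e'(3) list_all2_emb_iff[OF p _ fy] ee by blast
  next
    assume *: "d \<le> e \<and> le_at (e - d) p y"
    then have l: "le_at e p x" using le_at_trans[of "e - d" p y d x] yx by simp
    then have f: "fits N (e, p)" using le_at_fits by (auto simp: N_def)
    show "emb N (e, p) \<in> ?S"
      unfolding r embedding_iff N_def[symmetric] using l list_all2_emb_iff[OF p f fy] * by blast
  qed
  have all: "\<exists>e. \<eta> = emb N (e, p)" if "\<eta> \<in> ?S" for \<eta> using that by (auto simp: embedding_iff N_def)
  have pre: "prefix_embedding p x = emb N (0, p)" by (simp add: prefix_embedding_eq N_def)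
  have inj: "emb N (e, p) = emb N (0, p) \<longleftrightarrow> e = 0" for e
    using emb_inj[of N "(e, p)" "(0, p)"] p by auto
  show ?thesis unfolding d_def[symmetric] y_def[symmetric] pre
  proof
    assume S: "?S = {emb N (0, p)}"
    then have "d = 0 \<and> le_at 0 p y" using mem[of 0] by auto
    moreover have "e = 0" if "le_at e p y" for e
      using that mem[of e] S inj[of e] \<open>d = 0 \<and> le_at 0 p y\<close> by auto
    ultimately show "d = 0 \<and> le_at 0 p y \<and> (\<forall>e. le_at e p y \<longrightarrow> e = 0)" by blast
  next
    assume *: "d = 0 \<and> le_at 0 p y \<and> (\<forall>e. le_at e p y \<longrightarrow> e = 0)"
    show "?S = {emb N (0, p)}"
    proof
      show "{emb N (0, p)} \<subseteq> ?S" using mem[of 0] * by auto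
      show "?S \<subseteq> {emb N (0, p)}"
      proof
        fix \<eta> assume \<eta>: "\<eta> \<in> ?S"
        then obtain e where e: "\<eta> = emb N (e, p)" using all by blast
        then have "le_at e p y" using \<eta> mem[of e] * by simp
        then show "\<eta> \<in> {emb N (0, p)}" using * e by auto
      qed
    qed
  qed
qed

lemma other_embedding_iff:
  fixes p x :: "'a list"
  assumes "p \<noteq> []"
  shows "(\<exists>\<eta>. embedding p x \<eta> \<and> \<eta> \<noteq> prefix_embedding p x) \<longleftrightarrow> (\<exists>e>0. le_at e p x)"
proof
  assume "\<exists>\<eta>. embedding p x \<eta> \<and> \<eta> \<noteq> prefix_embedding p x"
  then obtain e where e: "le_at e p x" "emb (length x) (e, p) \<noteq> emb (length x) (0, p)"
    unfolding embedding_iff prefix_embedding_eq by blast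
  then have "0 < e" by (cases e) auto
  then show "\<exists>e>0. le_at e p x" using e by blast
next
  assume "\<exists>e>0. le_at e p x"
  then obtain e where e: "0 < e" "le_at e p x" by blast
  then have "emb (length x) (e, p) \<noteq> emb (length x) (0, p)"
    using emb_inj[of "length x" "(e, p)" "(0, p)"] assms by auto
  then show "\<exists>\<eta>. embedding p x \<eta> \<and> \<eta> \<noteq> prefix_embedding p x"
    unfolding embedding_iff prefix_embedding_eq using e by blast
qed

lemma two_embeddings_iff:
  fixes q x :: "'a list"
  assumes "q \<noteq> []" "le_at 0 q x"
  shows "(\<exists>\<eta> \<eta>'. embedding q x \<eta> \<and> embedding q x \<eta>' \<and> \<eta> \<noteq> \<eta>') \<longleftrightarrow> (\<exists>e>0. le_at e q x)"
proof -
  have "embedding q x (prefix_embedding q x)" using assms(2) embedding_iff prefix_embedding_eq by blast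
  then show ?thesis unfolding other_embedding_iff[OF assms(1), symmetric] by metis
qed

lemma principal_factor_iff:
  fixes p x :: "'a list"
  assumes p: "p \<noteq> []" and k: "word_reducible x (principal_index p x)"
  shows "principal_factor p x \<longleftrightarrow> \<not> flat x \<and> le_at 0 p x \<and> (\<exists>e>0. le_at e p x) \<and>
    (\<forall>q. le_at 0 q x \<and> le_at 0 p q \<and> length p < length q \<longrightarrow> (\<forall>e. le_at e q x \<longrightarrow> e = 0)) \<and>
    shift x (principal_index p x) = 0 \<and> le_at 0 p (red x (principal_index p x)) \<and>
    (\<forall>e. le_at e p (red x (principal_index p x)) \<longrightarrow> e = 0)"
proof -
  have "(\<forall>q. word_prefix q x \<and> word_prefix p q \<and> length p < length q \<longrightarrow>
        \<not> (\<exists>\<eta> \<eta>'. embedding q x \<eta> \<and> embedding q x \<eta>' \<and> \<eta> \<noteq> \<eta>')) \<longleftrightarrow>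
    (\<forall>q. le_at 0 q x \<and> le_at 0 p q \<and> length p < length q \<longrightarrow> (\<forall>e. le_at e q x \<longrightarrow> e = 0))"
    (is "(\<forall>q. ?A q) \<longleftrightarrow> (\<forall>q. ?B q)")
  proof -
    have "?A q \<longleftrightarrow> ?B q" for q
    proof (cases "le_at 0 q x \<and> le_at 0 p q \<and> length p < length q")
      case True
      then have "q \<noteq> []" by auto
      then show ?thesis using True two_embeddings_iff[of q x] unfolding word_prefix_iff by auto
    qed (auto simp: word_prefix_iff)
    then show ?thesis by simp
  qed
  then show ?thesis
    unfolding principal_factor_def only_prefix_embedding_iff[OF p k] other_embedding_iff[OF p]
      word_prefix_iff[of p x] by blast
qed

lemma run_drops:
  fixes x :: "'a list"
  assumes "valid (0, x) (l # ls)" "run (0, x) (l # ls) = (0, p)"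
  shows "drops p x l"
proof -
  have k: "word_reducible x l" using assms(1) by (simp add: enabled_def)
  have st: "step (0, x) l = (shift x l, red x l)" by (simp add: step_def)
  have "fst (step (0, x) l) \<le> 0" "le_at (0 - fst (step (0, x) l)) p (snd (step (0, x) l))"
    using run_le_at[of "step (0, x) l" ls] assms by auto
  then have s: "shift x l = 0" and le: "le_at 0 p (red x l)" using st by auto
  from k have "(if l < length p then Some (p ! l) else None) < Some (x ! l)"
  proof (cases rule: word_reducible_cases)
    case letter
    show ?thesis
    proof (cases "l < length p")
      case True
      then have "p ! l \<le> down (x ! l)" using le_at_nth[OF le, of l] letter by simp
      also have "down (x ! l) < x ! l" using letter down_less by blast
      finally show ?thesis using True by simp
    qed simp
  next
    case first
    then show ?thesis using s by simp
  next
    case last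
    then have "length p \<le> l" using le_at_length[OF le] by simp
    then show ?thesis by simp
  qed
  then show ?thesis using k by blast
qed

end

locale word_chain = rooted_forest_order T for T :: "'a::order itself" +
  fixes w u :: "'a list" and vs :: "'a list list" and ls :: "nat list"
  assumes nonempty: "u \<noteq> []"
    and valid: "valid (0, w) ls"
    and trace: "vs = trace (0, w) ls"
    and last: "snd (run (0, w) ls) = u"
begin

abbreviation n where "n \<equiv> length ls"

definition st where "st k = run (0, w) (take k ls)"

abbreviation off where "off k \<equiv> fst (st k)"

definition bad where
  "bad k j \<longleftrightarrow> (\<exists>l<ls ! k. enabled (st k) l \<and> word_le (vs ! j) (snd (step (st k) l)))"

lemma length_vs: "length vs = Suc n"
  by (simp add: trace)

lemma snd_st: "k \<le> n \<Longrightarrow> snd (st k) = vs ! k"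
  unfolding st_def trace by (simp add: nth_trace)

lemma st_eq: "k \<le> n \<Longrightarrow> st k = (off k, vs ! k)"
  by (simp add: prod_eq_iff snd_st)

lemma st_Suc: "k < n \<Longrightarrow> st (Suc k) = step (st k) (ls ! k)"
  unfolding st_def by (simp add: take_Suc_conv_app_nth)

lemma enabled_st: "k < n \<Longrightarrow> enabled (st k) (ls ! k)"
  using valid_drop[OF valid, of k] unfolding st_def by (simp add: Cons_nth_drop_Suc[symmetric])

lemma st_run: "i \<le> j \<Longrightarrow> st j = run (st i) (take (j - i) (drop i ls))"
  unfolding st_def
  by (metis foldl_append le_add_diff_inverse take_add)

lemma valid_segment: "valid (st i) (take m (drop i ls))"
  unfolding st_def using valid_take valid_drop valid by blast

lemma off_mono: "i \<le> j \<Longrightarrow> off i \<le> off j"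
  using run_le_at[OF valid_segment, of i "j - i"] st_run by simp

lemma chain_le_at: "i \<le> j \<Longrightarrow> j \<le> n \<Longrightarrow> le_at (off j - off i) (vs ! j) (vs ! i)"
  using run_le_at[OF valid_segment, of i "j - i"] st_run[of i j] snd_st[of i] snd_st[of j] by simp

lemma chain_word_le: "i \<le> j \<Longrightarrow> j \<le> n \<Longrightarrow> word_le (vs ! j) (vs ! i)"
  using chain_le_at word_le_iff by blast

lemma chain_covers: "k < n \<Longrightarrow> covers word_le (vs ! k) (vs ! Suc k)"
  using step_covers[OF enabled_st, of k] snd_st[of k] snd_st[of "Suc k"] st_Suc by simp

lemma chain_neq: "i < j \<Longrightarrow> j \<le> n \<Longrightarrow> vs ! j \<noteq> vs ! i"
proof
  assume ij: "i < j" "j \<le> n" and eq: "vs ! j = vs ! i"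
  then have "word_le (vs ! i) (vs ! Suc i)" using chain_word_le[of "Suc i" j] by simp
  then show False using chain_covers[of i] ij word_le_antisym unfolding covers_def by fastforce
qed

lemma chain_inj: "i \<le> n \<Longrightarrow> j \<le> n \<Longrightarrow> vs ! i = vs ! j \<longleftrightarrow> i = j"
  using chain_neq[of i j] chain_neq[of j i] by (metis nat_neq_iff)

lemma word_nonempty: "k \<le> n \<Longrightarrow> vs ! k \<noteq> []"
  using run_take_nonempty[OF valid, of k] last nonempty snd_st[of k] unfolding st_def by simp

lemma ids: "chain_id vs ls"
  using chain_id_trace[OF valid] last nonempty unfolding trace by simp

lemma max_chain: "maximal_chain u w vs"
  using trace_maximal_chain[OF valid] last unfolding trace by simp

lemma chain_embedding_st: "k \<le> n \<Longrightarrow> chain_embedding w ls k = emb (length w) (st k)"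
  unfolding st_def using chain_embedding_eq[OF valid_take[OF valid]] by simp

lemma offset_st: "k \<le> n \<Longrightarrow> offset (chain_embedding w ls k) = off k"
  using chain_embedding_st offset_emb[of "st k"] word_nonempty snd_st by simp

lemma bad_mono: "bad k j \<Longrightarrow> j \<le> j' \<Longrightarrow> j' \<le> n \<Longrightarrow> bad k j'"
  unfolding bad_def using chain_word_le word_le_trans by blast

lemma not_bad_Suc: "k < n \<Longrightarrow> \<not> bad k (Suc k)"
proof
  assume k: "k < n" and "bad k (Suc k)"
  then obtain l where l: "l < ls ! k" "enabled (st k) l" "word_le (vs ! Suc k) (snd (step (st k) l))"
    unfolding bad_def by blast
  have "covers word_le (vs ! k) (snd (step (st k) l))"
    using step_covers[OF l(2)] k snd_st[of k] by simp
  then have "snd (step (st k) l) = vs ! Suc k"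
    using l(3) chain_covers[OF k] unfolding covers_def by metis
  then have "l = ls ! k"
    using step_inj[OF l(2) enabled_st[OF k]] k st_Suc[of k] snd_st[of "Suc k"] by simp
  then show False using l(1) by simp
qed

lemma other_chain_trace:
  assumes "maximal_chain u w vs'" "chain_id vs' ls'"
  shows "valid (0, w) ls'" "vs' = trace (0, w) ls'" "snd (run (0, w) ls') = u"
proof -
  have "\<forall>v\<in>set vs'. v \<noteq> []"
    using maximal_chain_word_le[OF assms(1)] word_le_nonempty nonempty by blast
  note * = chain_id_imp_trace[OF assms(2) this]
  have h: "hd vs' = w" "List.last vs' = u" using assms(1) by (auto simp: maximal_chain_def)
  show "valid (0, w) ls'" "vs' = trace (0, w) ls'" using * h by auto
  then show "snd (run (0, w) ls') = u" using h(2) by simp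
qed

lemma chain_id_unique: "chain_id vs ls' \<Longrightarrow> ls' = ls"
  using other_chain_trace[OF max_chain, of ls'] valid_trace_inj[OF valid] trace by metis

lemma bad_imp_skipped:
  assumes "i \<le> k" "k < j" "j \<le> n" "Suc i < j" "bad k j"
  shows "skipped u w vs i j"
proof -
  obtain l where l: "l < ls ! k" "enabled (st k) l" "word_le (vs ! j) (snd (step (st k) l))"
    using assms(5) unfolding bad_def by blast
  have k: "k < n" using assms by simp
  obtain mid where mid: "valid (0, w) (take k ls @ l # mid)"
    "snd (run (0, w) (take k ls @ l # mid)) = vs ! j"
    "\<And>tail. (take k ls @ l # mid @ tail, ls) \<in> lexord less_than"
    using earlier_run[OF valid k l(1) l(2)[unfolded st_def] l(3)[unfolded st_def]] by blast
  define b where "b = fst (run (0, w) (take k ls @ l # mid))"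
  have b: "run (0, w) (take k ls @ l # mid) = (b, vs ! j)" using mid(2) by (simp add: b_def prod_eq_iff)
  define tail where "tail = map (\<lambda>x. x - off j + b) (drop j ls)"
  have vj: "valid (off j, vs ! j) (drop j ls)"
    using valid_drop[OF valid, of j] st_eq[OF assms(3)] by (simp add: st_def)
  note tr = valid_translate(1-3)[OF vj, of b, folded tail_def]
  define ls' where "ls' = take k ls @ l # mid @ tail"
  define vs' where "vs' = trace (0, w) ls'"
  have ls': "ls' = (take k ls @ l # mid) @ tail" by (simp add: ls'_def)
  have v': "valid (0, w) ls'" unfolding ls' valid_append[of _ "take k ls @ l # mid"] b using mid(1) tr(1) by blast
  have e: "run (off j, vs ! j) (drop j ls) = run (0, w) ls"
    using st_eq[OF assms(3)] by (metis append_take_drop_id foldl_append st_def)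
  have r': "snd (run (0, w) ls') = u" unfolding ls' foldl_append[of step _ "take k ls @ l # mid"] b tr(3) e last by simp
  have "maximal_chain u w vs'" using trace_maximal_chain[OF v'] r' by (simp add: vs'_def)
  moreover have "earlier_chain vs' vs" unfolding earlier_chain_def
    using ids chain_id_trace[OF v'] r' nonempty mid(3)[of tail] vs'_def ls'_def by metis
  moreover have "set vs - chain_interval vs i j \<subseteq> set vs'"
  proof
    fix v assume v: "v \<in> set vs - chain_interval vs i j"
    then obtain m where m: "m \<le> n" "v = vs ! m"
      using length_vs by (metis DiffD1 in_set_conv_nth less_Suc_eq_le)
    then have "m \<le> i \<or> j \<le> m" using v unfolding chain_interval_def by (auto simp: not_le[symmetric])
    then show "v \<in> set vs'"
    proof
      assume "m \<le> i"
      then have mk: "m \<le> k" using assms by simp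
      then have "take m ls' = take m ls" using k by (simp add: ls'_def min_def)
      moreover have ml: "m \<le> length ls'" using mk k by (simp add: ls'_def)
      ultimately have "vs' ! m = vs ! m"
        unfolding vs'_def trace using m(1) by (simp add: nth_trace)
      moreover have "m < length vs'" using ml by (simp add: vs'_def)
      ultimately show ?thesis using m by (metis nth_mem)
    next
      assume "j \<le> m"
      then have "v = drop j vs ! (m - j)" "m - j < length (drop j vs)" using m length_vs by auto
      then have "v \<in> set (drop j vs)" by (metis nth_mem)
      also have "drop j vs = trace (off j, vs ! j) (drop j ls)"
        using drop_trace[OF assms(3)] st_eq[OF assms(3)] unfolding trace st_def by metis
      finally show ?thesis unfolding vs'_def ls' trace_append[of _ "take k ls @ l # mid"] b tr(2) by simp
    qed
  qed
  moreover have "vs ! Suc i \<in> chain_interval vs i j" using assms unfolding chain_interval_def by auto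
  ultimately show ?thesis unfolding skipped_def by blast
qed

lemma skipped_imp_bad:
  assumes "j \<le> n" "skipped u w vs i j"
  shows "\<exists>k. i \<le> k \<and> k < j \<and> bad k j"
proof -
  obtain vs' where vs': "maximal_chain u w vs'" "earlier_chain vs' vs"
    "set vs - chain_interval vs i j \<subseteq> set vs'" and ne: "chain_interval vs i j \<noteq> {}"
    using assms unfolding skipped_def by blast
  then obtain ls' where ls': "chain_id vs' ls'" "(ls', ls) \<in> lexord less_than"
    unfolding earlier_chain_def using chain_id_unique by blast
  note o = other_chain_trace[OF vs'(1) ls'(1)]
  interpret other: word_chain T w u vs' ls' using o nonempty by unfold_locales auto
  obtain d where d: "d < n" "d < length ls'" "take d ls' = take d ls" "ls' ! d < ls ! d"
    using lexord_first_difference[OF valid o(1) _ ls'(2)] last o(3) by metis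
  have st: "other.st d = st d" using d(3) by (simp add: other.st_def st_def)
  have vd: "vs' ! d = vs ! d" using st snd_st[of d] other.snd_st[of d] d by simp
  have below: "word_le (vs ! m) (vs' ! Suc d)" if m: "d < m" "m \<le> n" "vs ! m \<in> set vs'" for m
  proof -
    obtain m' where m': "m' \<le> length ls'" "vs' ! m' = vs ! m"
      using m(3) other.length_vs by (metis in_set_conv_nth less_Suc_eq_le)
    have "d < m'"
    proof (rule ccontr)
      assume "\<not> d < m'"
      then have "word_le (vs ! d) (vs ! m)" using other.chain_word_le[of m' d] d m' vd by simp
      then show False
        using word_le_antisym[of "vs ! d" "vs ! m"] chain_word_le[of d m] chain_neq[of d m] m by simp
    qed
    then show ?thesis using other.chain_word_le[of "Suc d" m'] m' by simp
  qed
  have neq: "vs' ! Suc d \<noteq> vs ! Suc d"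
  proof
    assume "vs' ! Suc d = vs ! Suc d"
    then have "snd (step (st d) (ls' ! d)) = snd (step (st d) (ls ! d))"
      using other.st_Suc[of d] st_Suc[of d] other.snd_st[of "Suc d"] snd_st[of "Suc d"] d st by simp
    then have "ls' ! d = ls ! d" using step_inj other.enabled_st[of d] enabled_st[of d] d st by auto
    then show False using d by simp
  qed
  have ij: "i < d + 1 \<and> d < j"
  proof (rule ccontr)
    assume *: "\<not> (i < d + 1 \<and> d < j)"
    have "vs ! Suc d \<notin> chain_interval vs i j"
    proof
      assume "vs ! Suc d \<in> chain_interval vs i j"
      then obtain k where "i < k" "k < j" "vs ! Suc d = vs ! k" unfolding chain_interval_def by auto
      then show False using chain_inj[of "Suc d" k] assms(1) d * by auto
    qed
    moreover have "vs ! Suc d \<in> set vs" using d length_vs by simp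
    ultimately have "word_le (vs ! Suc d) (vs' ! Suc d)" using below[of "Suc d"] vs'(3) d by auto
    then show False
      using chain_covers[OF d(1)] other.chain_covers[OF d(2)] neq vd unfolding covers_def by metis
  qed
  have "vs ! j \<notin> chain_interval vs i j"
  proof
    assume "vs ! j \<in> chain_interval vs i j"
    then obtain k where "k < j" "vs ! j = vs ! k" unfolding chain_interval_def by auto
    then show False using chain_inj[of j k] assms(1) by auto
  qed
  then have "vs ! j \<in> set vs'" using vs'(3) assms(1) length_vs by auto
  then have "word_le (vs ! j) (vs' ! Suc d)" using below[of j] ij assms(1) by simp
  then have "word_le (vs ! j) (snd (step (st d) (ls' ! d)))"
    using other.st_Suc[of d] other.snd_st[of "Suc d"] d st by simp
  then have "bad d j" unfolding bad_def using other.enabled_st[of d] d st by auto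
  then show ?thesis using ij by (intro exI[of _ d]) auto
qed

lemma chain_interval_empty: "j \<le> Suc i \<Longrightarrow> chain_interval vs i j = {}"
  unfolding chain_interval_def by auto

lemma chain_interval_subset:
  assumes "b \<le> n" "j \<le> n" "Suc a < b" "chain_interval vs a b \<subseteq> chain_interval vs i j"
  shows "i \<le> a \<and> b \<le> j"
proof -
  have mem: "i < k \<and> k < j" if "a < k" "k < b" for k
  proof -
    have "vs ! k \<in> chain_interval vs i j" using assms(4) that unfolding chain_interval_def by auto
    then obtain k' where "i < k'" "k' < j" "vs ! k = vs ! k'" unfolding chain_interval_def by auto
    then show ?thesis using chain_inj[of k k'] that assms by auto
  qed
  have "i < Suc a" "b - 1 < j" using mem[of "Suc a"] mem[of "b - 1"] assms(3) by simp_all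
  then show ?thesis using assms(3) by linarith
qed

lemma minimally_skipped_iff:
  assumes "i < j" "j \<le> n"
  shows "minimally_skipped u w vs i j \<longleftrightarrow>
    Suc i < j \<and> bad i j \<and> (\<forall>k. i < k \<and> k < j \<longrightarrow> \<not> bad k j) \<and> \<not> bad i (j - 1)"
    (is "_ \<longleftrightarrow> ?R")
proof
  assume ms: "minimally_skipped u w vs i j"
  then have sk: "skipped u w vs i j" and
    min: "\<And>a b. a < b \<Longrightarrow> b < length vs \<Longrightarrow> chain_interval vs a b \<subset> chain_interval vs i j
      \<Longrightarrow> \<not> skipped u w vs a b"
    unfolding minimally_skipped_def by auto
  have ij: "Suc i < j" using sk chain_interval_empty[of j i] unfolding skipped_def by fastforce
  have no1: "\<not> bad k j" if k: "i < k" "k < j" for k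
  proof
    assume b: "bad k j"
    show False
    proof (cases "Suc k < j")
      case True
      have "vs ! Suc i \<notin> chain_interval vs k j"
      proof
        assume "vs ! Suc i \<in> chain_interval vs k j"
        then obtain m where "k < m" "m < j" "vs ! Suc i = vs ! m" unfolding chain_interval_def by auto
        then show False using chain_inj[of "Suc i" m] k assms by auto
      qed
      moreover have "vs ! Suc i \<in> chain_interval vs i j" using ij unfolding chain_interval_def by auto
      moreover have "chain_interval vs k j \<subseteq> chain_interval vs i j"
        using k unfolding chain_interval_def by force
      ultimately have "chain_interval vs k j \<subset> chain_interval vs i j" by blast
      then show False using min[of k j] bad_imp_skipped[of k k j] b k True assms length_vs by auto
    next
      case False
      then have "j = Suc k" using k by simp
      then show False using not_bad_Suc[of k] b assms by simp
    qed
  qed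
  obtain k where k: "i \<le> k" "k < j" "bad k j" using skipped_imp_bad[OF assms(2) sk] by blast
  then have "bad i j" using no1[of k] by (cases "k = i") auto
  moreover have "\<not> bad i (j - 1)"
  proof
    assume b: "bad i (j - 1)"
    show False
    proof (cases "Suc i < j - 1")
      case True
      have "vs ! (j - 1) \<notin> chain_interval vs i (j - 1)"
      proof
        assume "vs ! (j - 1) \<in> chain_interval vs i (j - 1)"
        then obtain m where "m < j - 1" "vs ! (j - 1) = vs ! m" unfolding chain_interval_def by auto
        moreover have "j - 1 \<le> n" using assms by simp
        ultimately show False using chain_neq[of m "j - 1"] by simp
      qed
      moreover have "vs ! (j - 1) \<in> chain_interval vs i j" using ij unfolding chain_interval_def by force
      moreover have "chain_interval vs i (j - 1) \<subseteq> chain_interval vs i j"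
        unfolding chain_interval_def by force
      ultimately have "chain_interval vs i (j - 1) \<subset> chain_interval vs i j" by blast
      moreover have jn: "j - 1 \<le> n" "i < j - 1" using assms True by linarith+
      ultimately have "\<not> skipped u w vs i (j - 1)" using min[of i "j - 1"] length_vs by simp
      then show False using bad_imp_skipped[of i i "j - 1"] b True jn by blast
    next
      case False
      then have "j - 1 = Suc i" using ij by simp
      then show False using not_bad_Suc[of i] b assms by simp
    qed
  qed
  ultimately show ?R using ij no1 by blast
next
  assume R: ?R
  then have "skipped u w vs i j" using bad_imp_skipped[of i i j] assms by auto
  moreover have "\<not> skipped u w vs a b"
    if ab: "a < b" "b < length vs" "chain_interval vs a b \<subset> chain_interval vs i j" for a b
  proof
    assume sk: "skipped u w vs a b"
    have bn: "b \<le> n" using ab length_vs by simp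
    have "Suc a < b" using sk chain_interval_empty[of b a] unfolding skipped_def by fastforce
    then have sub: "i \<le> a" "b \<le> j"
      using chain_interval_subset[OF bn assms(2), of a i] ab(3) by auto
    obtain k where k: "a \<le> k" "k < b" "bad k b" using skipped_imp_bad[OF bn sk] by blast
    then have "bad k j" using bad_mono sub assms by blast
    then have ki: "k = i" using R k sub by (metis le_neq_implies_less less_le_trans le_trans)
    then have "b \<noteq> j" using k(1) sub ab(3) by auto
    then have "bad i (j - 1)" using bad_mono[of i b "j - 1"] k ki sub assms by auto
    then show False using R by blast
  qed
  ultimately show "minimally_skipped u w vs i j" unfolding minimally_skipped_def by blast
qed

lemma chain_step_cases:
  assumes "k < n"
  obtains (letter) t where "ls ! k = off k + t" "t < length (vs ! k)" "\<not> minimal (vs ! k ! t)"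
      "vs ! Suc k = (vs ! k)[t := down (vs ! k ! t)]" "off (Suc k) = off k"
  | (first) "ls ! k = off k" "minimal (vs ! k ! 0)" "vs ! Suc k = tl (vs ! k)"
      "off (Suc k) = Suc (off k)"
  | (last) "ls ! k = off k + (length (vs ! k) - 1)" "1 < length (vs ! k)"
      "minimal (vs ! k ! (length (vs ! k) - 1))" "\<not> flat (vs ! k)" "vs ! Suc k = butlast (vs ! k)"
      "off (Suc k) = off k"
proof -
  define t where "t = ls ! k - off k"
  have e: "off k \<le> ls ! k" "word_reducible (vs ! k) t"
    using enabled_st[OF assms] snd_st[of k] assms by (auto simp: enabled_def t_def)
  have l: "ls ! k = off k + t" using e(1) by (simp add: t_def)
  have s: "vs ! Suc k = red (vs ! k) t" "off (Suc k) = off k + shift (vs ! k) t"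
    using st_Suc[OF assms] snd_st[of "Suc k"] snd_st[of k] assms by (auto simp: step_def t_def)
  from e(2) show thesis
  proof (cases rule: word_reducible_cases)
    case letter
    then show ?thesis using that(1)[of t] l s by simp
  next
    case first
    then show ?thesis using that(2) l s by simp
  next
    case last
    then show ?thesis using that(3) l s by simp
  qed
qed

lemma length_step: "k < n \<Longrightarrow> length (vs ! k) \<le> Suc (length (vs ! Suc k))"
  by (cases k rule: chain_step_cases) auto

lemma length_antimono: "i \<le> j \<Longrightarrow> j \<le> n \<Longrightarrow> length (vs ! j) \<le> length (vs ! i)"
  using chain_word_le word_le_length by blast

lemma strong_descent_iff:
  assumes "Suc m < n"
  shows "strong_descent vs ls (Suc m) \<longleftrightarrow> ls ! Suc m < ls ! m \<and>
    \<not> (\<exists>a b. minimal a \<and> minimal b \<and> vs ! m = vs ! Suc (Suc m) @ [a, b] \<and> off m = off (Suc (Suc m)))"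
proof -
  have "hd vs = w" by (simp add: trace)
  then show ?thesis
    using assms offset_st[of m] offset_st[of "Suc (Suc m)"]
    unfolding strong_descent_def descent_def by auto
qed

lemma badI:
  assumes "k < n" "t < ls ! k - off k" "word_reducible (vs ! k) t" "word_le (vs ! j) (red (vs ! k) t)"
  shows "bad k j"
  unfolding bad_def
  using assms snd_st[of k]
  by (intro exI[of _ "off k + t"]) (auto simp: enabled_def step_def)

lemma badE:
  assumes "bad k j" "k < n"
  obtains t where "t < ls ! k - off k" "word_reducible (vs ! k) t" "word_le (vs ! j) (red (vs ! k) t)"
proof -
  obtain l where "l < ls ! k" "enabled (st k) l" "word_le (vs ! j) (snd (step (st k) l))"
    using assms unfolding bad_def by blast
  then show thesis
    using that[of "l - off k"] snd_st[of k] assms(2) by (auto simp: enabled_def step_def)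
qed

lemma strong_descent_bad:
  assumes "Suc m < n" "strong_descent vs ls (Suc m)"
  shows "bad m (Suc (Suc m))"
proof -
  have desc: "ls ! Suc m < ls ! m" using assms strong_descent_iff by simp
  have offs: "off m \<le> off (Suc m)" "off (Suc m) \<le> ls ! Suc m"
    using off_mono[of m "Suc m"] enabled_st[of "Suc m"] assms by (auto simp: enabled_def)
  define t where "t = ls ! Suc m - off (Suc m)"
  have t: "word_reducible (vs ! Suc m) t" "vs ! Suc (Suc m) = red (vs ! Suc m) t"
    "ls ! Suc m = off (Suc m) + t"
    using enabled_st[of "Suc m"] st_Suc[of "Suc m"] snd_st[of "Suc m"] snd_st[of "Suc (Suc m)"] assms offs
    by (auto simp: enabled_def step_def t_def)
  have tl: "t < length (vs ! Suc m)" using t(1) by (simp add: word_reducible_def)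
  have m: "m < n" using assms by simp
  have off: "off (Suc m) = off m" using m desc offs by (cases m rule: chain_step_cases) auto
  have le: "le_at 0 (vs ! Suc m) (vs ! m)" using chain_le_at[of m "Suc m"] off assms by simp
  have same: "vs ! Suc m ! t = vs ! m ! t"
    using m
  proof (cases m rule: chain_step_cases)
    case (letter t')
    then show ?thesis using desc t(3) off by auto
  next
    case first
    then show ?thesis using off by simp
  next
    case last
    then show ?thesis using tl by (simp add: nth_butlast)
  qed
  have not_last: "t = 0" if min: "minimal (vs ! Suc m ! t)"
  proof (rule ccontr)
    assume t0: "t \<noteq> 0"
    from t(1) have l: "t = length (vs ! Suc m) - 1" "vs ! Suc (Suc m) = butlast (vs ! Suc m)"
      using min t0 t(2) by (cases rule: word_reducible_cases; simp)+
    have off2: "off (Suc (Suc m)) = off (Suc m)"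
      using st_Suc[of "Suc m"] assms t0 t_def by (auto simp: step_def shift_def)
    have "\<exists>a b. minimal a \<and> minimal b \<and> vs ! m = vs ! Suc (Suc m) @ [a, b]"
      using m
    proof (cases m rule: chain_step_cases)
      case (letter t')
      then show ?thesis using desc t(3) off l tl by auto
    next
      case first
      then show ?thesis using off by simp
    next
      case last
      have "vs ! m \<noteq> []" "vs ! Suc m \<noteq> []" using last(2) tl by auto
      then have e1: "vs ! Suc m @ [List.last (vs ! m)] = vs ! m"
        and e2: "vs ! Suc (Suc m) @ [List.last (vs ! Suc m)] = vs ! Suc m"
        using last(5) l(2) by simp_all
      have "vs ! m = (vs ! Suc (Suc m) @ [List.last (vs ! Suc m)]) @ [List.last (vs ! m)]"
        unfolding e2 e1 ..
      moreover have "minimal (List.last (vs ! m))" "minimal (List.last (vs ! Suc m))"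
        using last(3) min l(1) \<open>vs ! m \<noteq> []\<close> \<open>vs ! Suc m \<noteq> []\<close> by (simp_all add: last_conv_nth)
      ultimately show ?thesis by (intro exI[of _ "List.last (vs ! Suc m)"] exI[of _ "List.last (vs ! m)"]) simp
    qed
    then show False using strong_descent_iff[OF assms(1)] assms(2) off off2 by auto
  qed
  have "word_le (vs ! Suc (Suc m)) (red (vs ! m) t)"
    unfolding t(2) using le_at_mono_red[OF le tl same not_last] .
  moreover have "word_reducible (vs ! m) t"
  proof -
    have "t < length (vs ! m)" using tl le_at_length[OF le] by simp
    then show ?thesis using same not_last unfolding word_reducible_def by auto
  qed
  moreover have "t < ls ! m - off m" using desc t(3) off by linarith
  ultimately show ?thesis using badI[OF m] by blast
qed

lemma weak_descent:
  assumes "Suc m < n" "ls ! Suc m < ls ! m" "\<not> strong_descent vs ls (Suc m)"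
  shows "off (Suc m) = off m" "off (Suc (Suc m)) = off m" "ls ! Suc m = off m + length (vs ! Suc (Suc m))"
    "length (vs ! m) = Suc (Suc (length (vs ! Suc (Suc m))))"
    "length (vs ! Suc m) = Suc (length (vs ! Suc (Suc m)))"
    "vs ! Suc (Suc m) = butlast (vs ! Suc m)" "minimal (List.last (vs ! Suc m))"
proof -
  have "\<exists>a b. minimal a \<and> minimal b \<and> vs ! m = vs ! Suc (Suc m) @ [a, b] \<and> off m = off (Suc (Suc m))"
    using strong_descent_iff[OF assms(1)] assms(2,3) by argo
  then obtain a b where ab: "vs ! m = vs ! Suc (Suc m) @ [a, b]" "off m = off (Suc (Suc m))"
    by (elim exE conjE)
  show len: "length (vs ! m) = Suc (Suc (length (vs ! Suc (Suc m))))" unfolding ab(1) by simp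
  have "off m \<le> off (Suc m)" "off (Suc m) \<le> off (Suc (Suc m))" by (simp_all add: off_mono)
  then show off: "off (Suc m) = off m" "off (Suc (Suc m)) = off m"
    using ab(2) by linarith+
  have len2: "length (vs ! Suc m) = Suc (length (vs ! Suc (Suc m)))"
    using length_step[of m] length_step[of "Suc m"] len assms(1) by simp
  then show "length (vs ! Suc m) = Suc (length (vs ! Suc (Suc m)))" .
  from assms(1) have "vs ! Suc (Suc m) = butlast (vs ! Suc m) \<and> minimal (List.last (vs ! Suc m)) \<and>
    ls ! Suc m = off m + length (vs ! Suc (Suc m))"
  proof (cases "Suc m" rule: chain_step_cases)
    case (letter t)
    have "length (vs ! Suc (Suc m)) = length (vs ! Suc m)" unfolding letter(4) by simp
    then show ?thesis using len2 by linarith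
  next
    case first
    then show ?thesis using off by simp
  next
    case last
    then have "vs ! Suc m \<noteq> []" by auto
    then show ?thesis using last off by (auto simp: last_conv_nth)
  qed
  then show "ls ! Suc m = off m + length (vs ! Suc (Suc m))"
    "vs ! Suc (Suc m) = butlast (vs ! Suc m)" "minimal (List.last (vs ! Suc m))" by auto
qed

text \<open>Without strong descents a chain first reduces letters from left to right and then removes
  letters from the right end.\<close>

definition settled where
  "settled i k \<longleftrightarrow> off k = off i \<and>
     (\<forall>t < ls ! i - off i. t = 0 \<or> \<not> minimal (vs ! i ! t) \<longrightarrow>
        t < length (vs ! k) \<and> vs ! k ! t = vs ! i ! t) \<and>
     (length (vs ! k) = length (vs ! i) \<longrightarrow> ls ! i \<le> ls ! (k - 1)) \<and>
     (length (vs ! k) \<noteq> length (vs ! i) \<longrightarrow>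
        length (vs ! (k - 1)) = Suc (length (vs ! k)) \<and> ls ! (k - 1) = off i + length (vs ! k) \<and>
        vs ! k = butlast (vs ! (k - 1)) \<and> minimal (List.last (vs ! (k - 1))))"

lemma settledD:
  assumes "settled i k"
  shows "off k = off i"
    and "t < ls ! i - off i \<Longrightarrow> t = 0 \<or> \<not> minimal (vs ! i ! t) \<Longrightarrow>
      t < length (vs ! k) \<and> vs ! k ! t = vs ! i ! t"
    and "length (vs ! k) = length (vs ! i) \<Longrightarrow> ls ! i \<le> ls ! (k - 1)"
    and "length (vs ! k) \<noteq> length (vs ! i) \<Longrightarrow>
      ls ! (k - 1) = off i + length (vs ! k) \<and> length (vs ! (k - 1)) = Suc (length (vs ! k)) \<and>
      vs ! k = butlast (vs ! (k - 1)) \<and> minimal (List.last (vs ! (k - 1)))"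
  using assms unfolding settled_def by blast+

lemma settled_step:
  assumes k: "i \<le> k" "k < n" and "off i < ls ! i" and le: "ls ! i \<le> ls ! k" and off: "off k = off i"
    and len: "length (vs ! k) = length (vs ! i)"
    and same: "\<forall>t < ls ! i - off i. t = 0 \<or> \<not> minimal (vs ! i ! t) \<longrightarrow> vs ! k ! t = vs ! i ! t"
  shows "settled i (Suc k)"
  using k(2)
proof (cases k rule: chain_step_cases)
  case (letter t)
  have ti: "ls ! i - off i \<le> t" using le letter(1) off by simp
  have "s < length (vs ! Suc k) \<and> vs ! Suc k ! s = vs ! i ! s"
    if "s < ls ! i - off i" "s = 0 \<or> \<not> minimal (vs ! i ! s)" for s
    using that same ti letter(2,4) by auto
  then show ?thesis unfolding settled_def using letter len off le by auto
next
  case first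
  then show ?thesis using le off assms(3) by simp
next
  case last
  have ti: "ls ! i - off i \<le> length (vs ! k) - 1" using le last(1) off by simp
  have "s < length (vs ! Suc k) \<and> vs ! Suc k ! s = vs ! i ! s"
    if "s < ls ! i - off i" "s = 0 \<or> \<not> minimal (vs ! i ! s)" for s
    using that same ti last(2,5) by (auto simp: nth_butlast)
  moreover have "vs ! k \<noteq> []" using last(2) by auto
  ultimately show ?thesis unfolding settled_def using last len off le by (auto simp: last_conv_nth)
qed

lemma no_strong_descent_settled:
  assumes "Suc i \<le> k" "k \<le> n" "off i < ls ! i"
    and "\<And>m. i < m \<Longrightarrow> m < k \<Longrightarrow> \<not> strong_descent vs ls m"
  shows "settled i k"
  using assms
proof (induction k rule: dec_induct)
  case base
  then show ?case using settled_step[of i i] by simp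
next
  case (step k)
  then obtain k' where k': "k = Suc k'" "i \<le> k'" "Suc k' < n" by (cases k) auto
  have IH: "settled i (Suc k')" using step k' by simp
  have weak: "\<not> strong_descent vs ls (Suc k')" using step.prems(3)[of k] k' by simp
  have off: "off (Suc k') = off i" by (rule settledD(1)[OF IH])
  have same: "t < length (vs ! Suc k') \<and> vs ! Suc k' ! t = vs ! i ! t"
    if "t < ls ! i - off i" "t = 0 \<or> \<not> minimal (vs ! i ! t)" for t
    using settledD(2)[OF IH that] .
  show ?case unfolding k'(1)
  proof (cases "length (vs ! Suc k') = length (vs ! i)")
    case True
    have le: "ls ! i \<le> ls ! k'" using settledD(3)[OF IH True] by simp
    have "ls ! k' \<le> ls ! Suc k'"
    proof (rule ccontr)
      assume "\<not> ls ! k' \<le> ls ! Suc k'"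
      then have "length (vs ! k') = Suc (length (vs ! Suc k'))"
        using weak_descent(4,5)[OF k'(3) _ weak] by linarith
      moreover have "length (vs ! k') \<le> length (vs ! i)"
        using length_antimono[of i k'] k' by simp
      ultimately show False using True by linarith
    qed
    then show "settled i (Suc (Suc k'))"
      using settled_step[of i "Suc k'"] step.prems(2) k' le off True same by simp
  next
    case False
    have B: "ls ! k' = off i + length (vs ! Suc k')"
      using settledD(4)[OF IH False] unfolding diff_Suc_1 by blast
    have "ls ! Suc k' - off (Suc k') < length (vs ! Suc k')"
      using enabled_st[OF k'(3)] snd_st[of "Suc k'"] k'(3) by (simp add: enabled_def word_reducible_def)
    then have "ls ! Suc k' < ls ! k'" using B off by linarith
    note wd = weak_descent[OF k'(3) this weak]
    have all: "t < length (vs ! Suc (Suc k')) \<and> vs ! Suc (Suc k') ! t = vs ! i ! t"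
      if t: "t < ls ! i - off i" "t = 0 \<or> \<not> minimal (vs ! i ! t)" for t
    proof -
      have ne: "vs ! Suc (Suc k') \<noteq> []" "vs ! Suc k' \<noteq> []"
        using word_nonempty[of "Suc (Suc k')"] word_nonempty[of "Suc k'"] k'(3) by simp_all
      have "minimal (vs ! Suc k' ! length (vs ! Suc (Suc k')))"
        using wd(7) ne(2) wd(5) by (simp add: last_conv_nth)
      then have "t \<noteq> length (vs ! Suc (Suc k'))"
        using t same[OF t] ne(1) by auto
      then have "t < length (vs ! Suc (Suc k'))" using same[OF t] wd(5) by simp
      moreover from this have "vs ! Suc (Suc k') ! t = vs ! Suc k' ! t"
        unfolding wd(6) by (simp add: nth_butlast)
      ultimately show ?thesis using same[OF t] by simp
    qed
    have neq: "length (vs ! Suc (Suc k')) \<noteq> length (vs ! i)"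
      using length_antimono[of i "Suc k'"] wd(5) k' by linarith
    have eqs: "ls ! Suc k' = off i + length (vs ! Suc (Suc k'))" "off (Suc (Suc k')) = off i"
      using wd(1-3) off by linarith+
    show "settled i (Suc (Suc k'))"
      unfolding settled_def diff_Suc_1 using neq all eqs wd(5-7) by blast
  qed
qed

definition rel where "rel i j = map (\<lambda>l. l - off i) (take (j - i) (drop i ls))"

lemma rel_chain:
  assumes "i \<le> j" "j \<le> n"
  shows "valid (0, vs ! i) (rel i j)"
    and "trace (0, vs ! i) (rel i j) = take (Suc (j - i)) (drop i vs)"
    and "run (0, vs ! i) (rel i j) = (off j - off i, vs ! j)"
proof -
  have st: "st i = (off i, vs ! i)" using st_eq assms by simp
  have v: "valid (off i, vs ! i) (take (j - i) (drop i ls))" using valid_segment[of i "j - i"] st by simp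
  note tr = valid_translate(1-3)[OF v, of 0, unfolded add_0_right, folded rel_def]
  show "valid (0, vs ! i) (rel i j)" by (rule tr(1))
  have "drop i vs = trace (off i, vs ! i) (drop i ls)"
    using drop_trace[of i ls "(0, w)"] assms st unfolding trace st_def by simp
  then have "take (Suc (j - i)) (drop i vs) = trace (off i, vs ! i) (take (j - i) (drop i ls))"
    using take_trace[of "j - i" "drop i ls" "(off i, vs ! i)"] assms by (simp add: diff_le_mono)
  then show "trace (0, vs ! i) (rel i j) = take (Suc (j - i)) (drop i vs)" using tr(2) by simp
  have "run (off i, vs ! i) (take (j - i) (drop i ls)) = (off j, vs ! j)"
    using st_run[OF assms(1)] st st_eq[OF assms(2)] by simp
  then show "run (0, vs ! i) (rel i j) = (off j - off i, vs ! j)" using tr(3) by simp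
qed

lemma length_rel: "i \<le> j \<Longrightarrow> j \<le> n \<Longrightarrow> length (rel i j) = j - i"
  by (simp add: rel_def)

lemma nth_rel: "i \<le> j \<Longrightarrow> j \<le> n \<Longrightarrow> d < j - i \<Longrightarrow> rel i j ! d = ls ! (i + d) - off i"
  by (simp add: rel_def)

lemma rel_st:
  assumes "i \<le> j" "j \<le> n" "d \<le> j - i"
  shows "run (0, vs ! i) (take d (rel i j)) = (off (i + d) - off i, vs ! (i + d))"
proof -
  have "take d (rel i j) = rel i (i + d)"
    using assms(3) by (simp add: rel_def take_map min_def)
  then show ?thesis using rel_chain(3)[of i "i + d"] assms by simp
qed

lemma rel_word_chain:
  assumes "i \<le> j" "j \<le> n"
  shows "word_chain (vs ! i) (vs ! j) (take (Suc (j - i)) (drop i vs)) (rel i j)"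
  using rel_chain[OF assms] word_nonempty[OF assms(2)] by unfold_locales auto

lemma bad_if_earlier:
  assumes ij: "i \<le> j" "j \<le> n" and v: "valid (0, vs ! i) ls'" "snd (run (0, vs ! i) ls') = vs ! j"
    and lex: "(ls', rel i j) \<in> lexord less_than"
  obtains d where "d < j - i" "d < length ls'" "take d ls' = take d (rel i j)"
    "ls' ! d < rel i j ! d" "bad (i + d) j"
proof -
  obtain d where d: "d < length (rel i j)" "d < length ls'" "take d ls' = take d (rel i j)"
    "ls' ! d < rel i j ! d"
    using lexord_first_difference[OF rel_chain(1)[OF ij] v(1) _ lex] rel_chain(3)[OF ij] v(2) by auto
  have dj: "d < j - i" using d(1) length_rel[OF ij] by simp
  define a where "a = off (i + d) - off i"
  have o: "off i \<le> off (i + d)" by (simp add: off_mono)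
  have s: "run (0, vs ! i) (take d ls') = (a, vs ! (i + d))"
    using d(3) rel_st[OF ij] dj by (simp add: a_def)
  have v2: "valid (a, vs ! (i + d)) (ls' ! d # drop (Suc d) ls')"
    using valid_drop[OF v(1), of d] s d(2) by (simp add: Cons_nth_drop_Suc)
  then have en: "a \<le> ls' ! d" "word_reducible (vs ! (i + d)) (ls' ! d - a)"
    by (auto simp: enabled_def)
  have "run (a, vs ! (i + d)) (ls' ! d # drop (Suc d) ls') = run (0, vs ! i) ls'"
    using s d(2) by (metis Cons_nth_drop_Suc append_take_drop_id foldl_append)
  then have "word_le (vs ! j) (snd (step (a, vs ! (i + d)) (ls' ! d)))"
    using run_word_le[of "step (a, vs ! (i + d)) (ls' ! d)" "drop (Suc d) ls'"] v2 v(2) by simp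
  then have le: "word_le (vs ! j) (red (vs ! (i + d)) (ls' ! d - a))" by (simp add: step_def)
  have "ls' ! d - a < ls ! (i + d) - off (i + d)"
    using d(4) nth_rel[OF ij dj] en(1) o unfolding a_def by linarith
  then have "bad (i + d) j" using badI[of "i + d", OF _ _ en(2) le] ij dj by simp
  then show thesis using that d dj by blast
qed

lemma last_embedding_rel:
  assumes "i \<le> j" "j \<le> n"
  shows "chain_embedding (vs ! i) (rel i j) (length (rel i j)) =
    emb (length (vs ! i)) (off j - off i, vs ! j)"
  using chain_embedding_eq[of "vs ! i" "length (rel i j)" "rel i j"] rel_chain[OF assms] by simp

lemma skipped_imp_principal:
  assumes ij: "Suc i < j" "j \<le> n" and bad: "bad i j"
    and not_bad: "\<And>k. i < k \<Longrightarrow> k < j \<Longrightarrow> \<not> bad k j" and not_bad': "\<not> bad i (j - 1)"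
    and weak: "\<And>m. i < m \<Longrightarrow> m < j \<Longrightarrow> \<not> strong_descent vs ls m"
  shows "principal_factor (vs ! j) (vs ! i)"
    and "ls ! i = off i + principal_index (vs ! j) (vs ! i)"
    and "first_admissible_chain (vs ! j) (vs ! i) (prefix_embedding (vs ! j) (vs ! i))
       (take (Suc (j - i)) (drop i vs))"
proof -
  define p where "p = vs ! j"
  define x where "x = vs ! i"
  define k where "k = ls ! i - off i"
  have i: "i < n" "i \<le> n" "i \<le> j" using ij by simp_all
  have lsi: "ls ! i = off i + k" using enabled_st[OF i(1)] by (simp add: enabled_def k_def)
  have kr: "word_reducible x k"
    using enabled_st[OF i(1)] snd_st[of i] i by (simp add: enabled_def k_def x_def)
  have kx: "k < length x" using kr by (simp add: word_reducible_def)
  have x1: "vs ! Suc i = red x k" "off (Suc i) = off i + shift x k"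
    using st_Suc[OF i(1)] snd_st[of i] snd_st[of "Suc i"] i by (simp_all add: step_def k_def x_def)
  have pne: "p \<noteq> []" using word_nonempty[OF ij(2)] by (simp add: p_def)
  have xne: "x \<noteq> []" using word_nonempty[OF i(2)] by (simp add: x_def)
  obtain t where t: "t < k" "word_reducible x t" "word_le p (red x t)"
    using badE[OF bad i(1)] by (auto simp: k_def x_def p_def)
  then have k0: "0 < k" by simp
  have settled: "settled i j" using no_strong_descent_settled[of i j] ij k0 lsi weak by simp
  note sd = settledD[OF settled]
  have kept: "s < length p \<and> p ! s = x ! s" if s: "s < k" "word_reducible x s" for s
  proof -
    have "s = 0 \<or> \<not> minimal (x ! s)" using s kx unfolding word_reducible_def by auto
    then show ?thesis using sd(2)[of s] s by (simp add: k_def x_def p_def)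
  qed
  have off: "off j = off i" by (rule sd(1))
  have px: "le_at 0 p x" using chain_le_at[OF i(3) ij(2)] off by (simp add: p_def x_def)
  have sh: "shift x k = 0" using k0 by simp
  have px1: "le_at 0 p (red x k)"
    using chain_le_at[of "Suc i" j] ij off x1 sh by (simp add: p_def)
  have other: "\<exists>e>0. le_at e p x"
    using t(2)
  proof (cases rule: word_reducible_cases)
    case letter
    obtain e where e: "le_at e p (red x t)" using t(3) word_le_iff by blast
    have "e \<noteq> 0"
    proof
      assume "e = 0"
      then have "p ! t \<le> down (x ! t)" using le_at_nth[OF e, of t] kept[OF t(1,2)] letter by simp
      then show False using kept[OF t(1,2)] down_less[OF letter(2)] by auto
    qed
    moreover have "le_at e p x" using le_at_trans[OF e le_at_red[OF t(2)]] letter(4) by simp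
    ultimately show ?thesis by auto
  next
    case first
    obtain e where e: "le_at e p (red x t)" using t(3) word_le_iff by blast
    have "le_at (Suc e) p x" using le_at_trans[OF e le_at_red[OF t(2)]] first(4) by simp
    then show ?thesis by blast
  next
    case last
    then show ?thesis using t(1) kx by simp
  qed
  obtain rest where rel: "rel i j = k # rest"
    using length_rel[OF i(3) ij(2)] nth_rel[OF i(3) ij(2), of 0] ij(1) unfolding k_def
    by (cases "rel i j") auto
  have "run (0, x) (rel i j) = (0, p)" "valid (0, x) (rel i j)"
    using rel_chain[OF i(3) ij(2)] off by (simp_all add: x_def p_def)
  then have drop: "drops p x k" using run_drops[of x k rest p] rel by simp
  have least: "s < k \<Longrightarrow> \<not> drops p x s" for s using kept[of s] by auto
  have index: "principal_index p x = k" unfolding principal_index_def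
  proof (rule Least_equality)
    show "drops p x k" by (rule drop)
    show "k \<le> s" if "drops p x s" for s using least[of s] that by (meson not_le)
  qed
  then show "ls ! i = off i + principal_index (vs ! j) (vs ! i)" using lsi by (simp add: p_def x_def)
  have zero: "word_reducible x 0" using word_reducible_zero xne by blast
  have "\<not> flat x"
  proof
    assume fl: "flat x"
    then obtain m where m: "minimal m" "set x \<subseteq> {m}" unfolding flat_def by blast
    then have "x ! k = m" using kx nth_mem by blast
    then show False using kr k0 fl m(1) unfolding word_reducible_def by simp
  qed
  moreover have "e = 0" if e: "le_at e p (red x k)" for e
  proof (rule ccontr)
    assume "e \<noteq> 0"
    then have le: "word_le (vs ! j) (red (vs ! Suc i) 0)"
      using word_le_red_zero[OF e] x1(1) by (simp add: p_def)
    have r0: "word_reducible (vs ! Suc i) 0" using word_reducible_zero word_nonempty[of "Suc i"] ij by simp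
    have n1: "Suc i < n" using ij by simp
    have off1: "off (Suc i) = off i" using x1(2) sh by simp
    have "\<not> 0 < ls ! Suc i - off (Suc i)" using badI[OF n1 _ r0 le] not_bad[of "Suc i"] ij by auto
    then have d: "ls ! Suc i < ls ! i" using off1 lsi k0 by linarith
    have "ls ! Suc i = off i + length (vs ! Suc (Suc i))"
      using weak_descent(3)[OF n1 d] weak[of "Suc i"] ij by simp
    moreover have "length (vs ! Suc (Suc i)) > 0" using word_nonempty[of "Suc (Suc i)"] n1 by simp
    ultimately show False using \<open>\<not> 0 < ls ! Suc i - off (Suc i)\<close> off1 by linarith
  qed
  moreover have "e = 0" if q: "le_at 0 q x" "le_at 0 p q" "length p < length q" and e: "le_at e q x" for q e
  proof (rule ccontr)
    assume e0: "e \<noteq> 0"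
    define y where "y = vs ! (j - 1)"
    have "length p < length x" using q le_at_length[OF q(1)] by simp
    then have ne: "length (vs ! j) \<noteq> length (vs ! i)" by (simp add: p_def x_def)
    have leny: "length y = Suc (length p)" and py: "p = butlast y" and miny: "minimal (List.last y)"
      using sd(4)[OF ne] unfolding y_def p_def by blast+
    have "off (j - 1) = off i" using off_mono[of i "j - 1"] off_mono[of "j - 1" j] off ij by simp
    then have yx: "le_at 0 y x" using chain_le_at[of i "j - 1"] ij by (simp add: y_def x_def)
    have "le_at 0 y q" unfolding le_at_def
    proof (intro conjI allI impI)
      show "0 + length y \<le> length q" using leny q(3) by simp
      fix s assume s: "s < length y"
      show "y ! s \<le> q ! (0 + s)"
      proof (cases "s < length p")
        case True
        then have "y ! s = p ! s" unfolding py by (simp add: nth_butlast)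
        then show ?thesis using le_at_nth[OF q(2) True] by simp
      next
        case False
        then have sp: "s = length p" using s leny by simp
        have "y \<noteq> []" using s by auto
        then have "minimal (y ! s)" using miny sp leny by (simp add: last_conv_nth)
        moreover have "y ! s \<le> x ! s" using le_at_nth[OF yx s] by simp
        moreover have "q ! s \<le> x ! s" using le_at_nth[OF q(1), of s] sp q(3) by simp
        ultimately show ?thesis using lower_set_chain[of "y ! s" "x ! s" "q ! s"] minimal_le by fastforce
      qed
    qed
    then have "le_at e y x" using le_at_trans[of 0 y q e x] e by simp
    then have "word_le (vs ! (j - 1)) (red (vs ! i) 0)"
      using word_le_red_zero[of e y x] e0 by (simp add: y_def x_def)
    then show False using badI[of i 0 "j - 1"] zero k0 i not_bad' by (simp add: k_def x_def)
  qed
  moreover have "word_reducible x (principal_index p x)" using kr index by simp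
  ultimately have "principal_factor p x"
    using principal_factor_iff[OF pne, of x] px other sh px1 unfolding index by blast
  then show "principal_factor (vs ! j) (vs ! i)" by (simp add: p_def x_def)
  interpret seg: word_chain T x p "take (Suc (j - i)) (drop i vs)" "rel i j"
    using rel_word_chain[OF i(3) ij(2)] by (simp add: p_def x_def)
  have "first_admissible_chain p x (prefix_embedding p x) (take (Suc (j - i)) (drop i vs))"
    unfolding first_admissible_chain_def
  proof (intro conjI exI[of _ "rel i j"] allI impI)
    show "maximal_chain p x (take (Suc (j - i)) (drop i vs))" by (rule seg.max_chain)
    show "chain_id (take (Suc (j - i)) (drop i vs)) (rel i j)" by (rule seg.ids)
    show "chain_embedding x (rel i j) (length (rel i j)) = prefix_embedding p x"
      using last_embedding_rel[OF i(3) ij(2)] off by (simp add: prefix_embedding_eq p_def x_def)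
    fix vs' ls'
    assume *: "maximal_chain p x vs' \<and> chain_id vs' ls' \<and>
      chain_embedding x ls' (length ls') = prefix_embedding p x"
    then have o: "valid (0, x) ls'" "snd (run (0, x) ls') = p"
      using seg.other_chain_trace[of vs' ls'] by auto
    have "emb (length x) (run (0, x) ls') = emb (length x) (0, p)"
      using * chain_embedding_eq[of x "length ls'" ls'] o(1) by (simp add: prefix_embedding_eq)
    then have r: "run (0, x) ls' = (0, p)" using emb_inj o(2) pne by blast
    have "(ls', rel i j) \<notin> lexord less_than"
    proof
      assume lex: "(ls', rel i j) \<in> lexord less_than"
      obtain d where d: "d < j - i" "d < length ls'" "take d ls' = take d (rel i j)"
        "ls' ! d < rel i j ! d" "bad (i + d) j"
        using bad_if_earlier[OF i(3) ij(2) _ _ lex] o by (auto simp: x_def p_def)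
      have "d = 0"
      proof (rule ccontr)
        assume "d \<noteq> 0"
        then have "\<not> bad (i + d) j" using d(1) by (intro not_bad) linarith+
        then show False using d(5) by blast
      qed
      then obtain l ls'' where ls'': "ls' = l # ls''" "l < k" using d rel by (cases ls') auto
      then show False using run_drops[of x l ls'' p] o(1) r least[of l] by simp
    qed
    then show "ls' = rel i j \<or> (rel i j, ls') \<in> lexord less_than"
      using lexord_linear[of less_than "rel i j" ls'] by (metis less_than_iff linorder_less_linear)
  qed
  then show "first_admissible_chain (vs ! j) (vs ! i) (prefix_embedding (vs ! j) (vs ! i))
       (take (Suc (j - i)) (drop i vs))" by (simp add: p_def x_def)
qed

lemma principal_imp_skipped:
  assumes ij: "i < j" "j \<le> n"
    and pf: "principal_factor (vs ! j) (vs ! i)"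
    and index: "ls ! i = off i + principal_index (vs ! j) (vs ! i)"
    and first: "first_admissible_chain (vs ! j) (vs ! i) (prefix_embedding (vs ! j) (vs ! i))
       (take (Suc (j - i)) (drop i vs))"
  shows "Suc i < j" "bad i j" "\<And>k. i < k \<Longrightarrow> k < j \<Longrightarrow> \<not> bad k j" "\<not> bad i (j - 1)"
proof -
  define p where "p = vs ! j"
  define x where "x = vs ! i"
  define k0 where "k0 = principal_index p x"
  have i: "i < n" "i \<le> n" "i \<le> j" using ij by simp_all
  have lsi: "ls ! i = off i + k0" using index by (simp add: k0_def p_def x_def)
  have pne: "p \<noteq> []" using word_nonempty[OF ij(2)] by (simp add: p_def)
  have xne: "x \<noteq> []" using word_nonempty[OF i(2)] by (simp add: x_def)
  have pf: "principal_factor p x" using pf by (simp add: p_def x_def)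
  have nf: "\<not> flat x" and "\<exists>e>0. le_at e p x"
    using pf unfolding principal_factor_def other_embedding_iff[OF pne] by simp_all
  then obtain e where e: "0 < e" "le_at e p x" by blast
  then have "length p \<le> length x - 1" using le_at_length[OF e(2)] by linarith
  then have "drops p x (length x - 1)" using nf xne unfolding word_reducible_def by simp
  then have k0: "drops p x k0" unfolding k0_def principal_index_def by (rule LeastI)
  then have kr: "word_reducible x k0" by blast
  then have kx: "k0 < length x" by (simp add: word_reducible_def)
  note pf' = pf[unfolded principal_factor_iff[OF pne kr[unfolded k0_def]], folded k0_def]
  have px: "le_at 0 p x" and sh: "shift x k0 = 0" and px1: "le_at 0 p (red x k0)"
    using pf' by simp_all
  have unique: "f = 0" if "le_at 0 q x" "le_at 0 p q" "length p < length q" "le_at f q x" for q f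
    using pf' that by blast
  have only: "f = 0" if "le_at f p (red x k0)" for f using pf' that by blast
  have kept: "s < length p \<and> p ! s = x ! s" if s: "s < k0" "word_reducible x s" for s
  proof -
    have "\<not> drops p x s" using not_less_Least[of s "drops p x"] s(1)
      unfolding k0_def principal_index_def by blast
    then have "s < length p" "\<not> p ! s < x ! s" using s(2) by (auto split: if_splits)
    then show ?thesis using le_at_nth[OF px, of s] by auto
  qed
  have pos: "0 < k0"
  proof (rule ccontr)
    assume "\<not> 0 < k0"
    then have z: "k0 = 0" by simp
    then have "red x k0 = x[0 := down (x ! 0)]" using sh unfolding shift_def red_def by (auto split: if_splits)
    then have "le_at e p (red x k0)" using e unfolding le_at_def by auto
    then show False using only e(1) by blast
  qed
  have "word_reducible x 0" using word_reducible_zero xne by blast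
  then show bad: "bad i j"
    using badI[of i 0 j] word_le_red_zero[OF e(2,1)] i lsi pos by (simp add: p_def x_def)
  then show sij: "Suc i < j" using not_bad_Suc[OF i(1)] ij(1) by (cases "j = Suc i") auto
  interpret seg: word_chain T x p "take (Suc (j - i)) (drop i vs)" "rel i j"
    using rel_word_chain[OF i(3) ij(2)] by (simp add: p_def x_def)
  obtain ls0 where ls0: "chain_id (take (Suc (j - i)) (drop i vs)) ls0"
    "chain_embedding x ls0 (length ls0) = prefix_embedding p x"
    "\<And>vs' ls'. maximal_chain p x vs' \<Longrightarrow> chain_id vs' ls' \<Longrightarrow>
       chain_embedding x ls' (length ls') = prefix_embedding p x \<Longrightarrow>
       ls' = ls0 \<or> (ls0, ls') \<in> lexord less_than"
    using first unfolding first_admissible_chain_def p_def[symmetric] x_def[symmetric] by blast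
  have ls0_rel: "ls0 = rel i j" using seg.chain_id_unique[OF ls0(1)] .
  have "emb (length x) (off j - off i, p) = emb (length x) (0, p)"
    using ls0(2) last_embedding_rel[OF i(3) ij(2)] unfolding ls0_rel prefix_embedding_eq p_def x_def by simp
  then have off: "off j = off i"
    using emb_inj[of "length x" "(off j - off i, p)" "(0, p)"] pne off_mono[OF i(3)] by simp
  have offk: "off k = off i" if "i \<le> k" "k \<le> j" for k
    using off_mono[OF that(1)] off_mono[OF that(2)] off by simp
  obtain rest where rel: "rel i j = k0 # rest"
    using length_rel[OF i(3) ij(2)] nth_rel[OF i(3) ij(2), of 0] ij(1) lsi
    by (cases "rel i j") auto
  show not_bad: "\<not> bad k j" if k: "i < k" "k < j" for k
  proof
    assume "bad k j"
    then obtain t where t: "t < ls ! k - off k" "word_reducible (vs ! k) t" "word_le p (red (vs ! k) t)"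
      using badE[of k j] k ij by (auto simp: p_def)
    define d where "d = k - i"
    have d: "0 < d" "d < j - i" "i + d = k" using k by (auto simp: d_def)
    have s: "run (0, x) (take d (rel i j)) = (0, vs ! k)"
      using rel_st[OF i(3) ij(2), of d] d offk[of k] k by (simp add: x_def)
    have t1: "t < rel i j ! d" using t(1) nth_rel[OF i(3) ij(2) d(2)] d(3) offk[of k] k by simp
    have t2: "enabled (run (0, x) (take d (rel i j))) t" using t(2) s by (simp add: enabled_def)
    have t3: "word_le p (snd (step (run (0, x) (take d (rel i j))) t))" using t(3) s by (simp add: step_def)
    have dl: "d < length (rel i j)" using d length_rel[OF i(3) ij(2)] by simp
    obtain mid where mid: "valid (0, x) (take d (rel i j) @ t # mid)"
      "snd (run (0, x) (take d (rel i j) @ t # mid)) = p"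
      "\<And>tail. (take d (rel i j) @ t # mid @ tail, rel i j) \<in> lexord less_than"
      using earlier_run[OF seg.valid dl t1 t2 t3] by blast
    define ls' where "ls' = take d (rel i j) @ t # mid"
    have v': "valid (0, x) ls'" and r': "snd (run (0, x) ls') = p" and lex: "(ls', rel i j) \<in> lexord less_than"
      using mid(1,2) mid(3)[of "[]"] by (simp_all add: ls'_def)
    have mc: "maximal_chain p x (trace (0, x) ls')" using trace_maximal_chain[OF v'] r' by simp
    have id: "chain_id (trace (0, x) ls') ls'" using chain_id_trace[OF v'] r' pne by simp
    obtain rest' where ls': "ls' = k0 # rest'" using d(1) rel by (cases d) (auto simp: ls'_def)
    have "step (0, x) k0 = (0, red x k0)" using sh by (simp add: step_def)
    then have "le_at (fst (run (0, x) ls')) p (red x k0)"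
      using run_le_at[of "step (0, x) k0" rest'] v' r' ls' by simp
    then have "run (0, x) ls' = (0, p)" using only r' by (simp add: prod_eq_iff)
    then have "chain_embedding x ls' (length ls') = prefix_embedding p x"
      using chain_embedding_eq[of x "length ls'" ls'] v' by (simp add: prefix_embedding_eq)
    then have "ls' = rel i j \<or> (rel i j, ls') \<in> lexord less_than"
      using ls0(3)[OF mc id] ls0_rel by simp
    moreover have "asym less_than" by (rule asymI) simp
    ultimately show False using lex lexord_asymmetric[of less_than ls' "rel i j"] by auto
  qed
  show "\<not> bad i (j - 1)"
  proof
    assume "bad i (j - 1)"
    then obtain t where t: "t < k0" "word_reducible x t" "word_le (vs ! (j - 1)) (red x t)"
      using badE[of i "j - 1"] i lsi by (auto simp: x_def)
    define q where "q = vs ! (j - 1)"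
    have j1: "j - 1 < n" "Suc (j - 1) = j" "i \<le> j - 1" "j - 1 \<le> j" "j - 1 \<le> n" using ij by simp_all
    have qx: "le_at 0 q x" using chain_le_at[of i "j - 1"] offk[of "j - 1"] j1 by (simp add: q_def x_def)
    have pq: "le_at 0 p q"
      using chain_le_at[of "j - 1" j] offk[of "j - 1"] off j1 ij by (simp add: q_def p_def)
    have "length q = length p \<or> length q = Suc (length p)"
      using length_step[OF j1(1)] le_at_length[OF pq] j1(2) by (auto simp: q_def p_def)
    then show False
    proof
      assume lq: "length q = Suc (length p)"
      obtain f where f: "le_at f q (red x t)" using t(3) word_le_iff by (auto simp: q_def)
      have fx: "le_at (shift x t + f) q x" using le_at_trans[OF f le_at_red[OF t(2)]] .
      then have z: "shift x t = 0" "f = 0" using unique[OF qx pq _ fx] lq by simp_all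
      from t(2) show False
      proof (cases rule: word_reducible_cases)
        case letter
        have tp: "t < length p" "p ! t = x ! t" using kept[OF t(1,2)] by auto
        have "p ! t \<le> q ! t" using le_at_nth[OF pq tp(1)] by simp
        also have "q ! t \<le> down (x ! t)" using le_at_nth[OF f, of t] z tp lq letter by simp
        also have "down (x ! t) < x ! t" by (rule down_less[OF letter(2)])
        finally show False using tp by simp
      next
        case first
        then show False using z by simp
      next
        case last
        then show False using t(1) kx by simp
      qed
    next
      assume lq: "length q = length p"
      have px_len: "length p < length x" using le_at_length[OF e(2)] e(1) by simp
      define m where "m = (LEAST m. i \<le> m \<and> length (vs ! m) = length p)"
      have P: "i \<le> j - 1 \<and> length (vs ! (j - 1)) = length p" using j1 lq by (simp add: q_def)
      have m: "i \<le> m" "length (vs ! m) = length p" "m \<le> j - 1"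
        using LeastI[of "\<lambda>m. i \<le> m \<and> length (vs ! m) = length p", OF P]
          Least_le[of "\<lambda>m. i \<le> m \<and> length (vs ! m) = length p", OF P] unfolding m_def by blast+
      have "m \<noteq> i" using m(2) px_len by (auto simp: x_def)
      then obtain s where s: "m = Suc s" "i \<le> s" using m(1) by (cases m) auto
      have sn: "s < n" "Suc s < n" "Suc (Suc s) \<le> j" "s < j" using m(3) s ij j1 by simp_all
      have "length (vs ! s) \<noteq> length p"
        using not_less_Least[of s "\<lambda>m. i \<le> m \<and> length (vs ! m) = length p"] s unfolding m_def by auto
      then have ls1: "length (vs ! s) = Suc (length p)" "length (vs ! Suc s) = length p"
        using length_step[OF sn(1)] length_antimono[of s "Suc s"] m(2) s(1) sn by auto
      have ls2: "length (vs ! Suc (Suc s)) = length p"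
        using length_antimono[of "Suc s" "Suc (Suc s)"] length_antimono[of "Suc (Suc s)" j] sn ij ls1
        by (simp add: p_def)
      have offs: "off s = off i" "off (Suc s) = off i" "off (Suc (Suc s)) = off i"
        using offk[of s] offk[of "Suc s"] offk[of "Suc (Suc s)"] s(2) sn by simp_all
      have "ls ! s = off i + length p \<and> vs ! Suc s = butlast (vs ! s)"
        using sn(1)
      proof (cases s rule: chain_step_cases)
        case (letter t)
        have "length (vs ! Suc s) = length (vs ! s)" unfolding letter(4) by simp
        then show ?thesis using ls1 by simp
      next
        case first
        then show ?thesis using offs by simp
      next
        case last
        then show ?thesis using offs(1) ls1(1) by simp
      qed
      then have del: "ls ! s = off i + length p" "vs ! Suc s = butlast (vs ! s)" by blast+
      obtain r where r: "r < length p" "\<not> minimal (vs ! Suc s ! r)"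
        "vs ! Suc (Suc s) = (vs ! Suc s)[r := down (vs ! Suc s ! r)]"
        using sn(2)
      proof (cases "Suc s" rule: chain_step_cases)
        case (letter t)
        then show thesis using that[of t] ls1(2) by simp
      next
        case first
        then show thesis using offs by simp
      next
        case last
        have "length (vs ! Suc (Suc s)) = length (vs ! Suc s) - 1" unfolding last(5) by simp
        then show thesis using ls1 ls2 last(2) by simp
      qed
      have same: "vs ! Suc s ! r = vs ! s ! r" unfolding del(2) using r(1) ls1 by (simp add: nth_butlast)
      have le: "le_at 0 (vs ! Suc s) (vs ! s)" using chain_le_at[of s "Suc s"] sn offs by simp
      have "red (vs ! Suc s) r = vs ! Suc (Suc s)" using r by (simp add: red_def)
      then have "word_le (vs ! Suc (Suc s)) (red (vs ! s) r)"
        using le_at_mono_red[OF le _ same] r ls1 by simp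
      then have above: "word_le (vs ! j) (red (vs ! s) r)"
        using chain_word_le[OF sn(3) ij(2)] word_le_trans by blast
      have rr: "word_reducible (vs ! s) r" using r same ls1 unfolding word_reducible_def by simp
      have "bad s j" using badI[OF sn(1) _ rr above] del(1) offs r(1) by simp
      then have si: "s = i" using not_bad[of s] s(2) sn(4) by (cases "s = i") auto
      then have "k0 = length p" using del(1) lsi by simp
      then have "p ! r = x ! r" using kept[of r] r(1) rr si by (simp add: x_def)
      moreover have "p ! r \<le> vs ! Suc (Suc s) ! r"
        using chain_le_at[OF sn(3) ij(2)] off offs(3) r(1) le_at_nth[of 0 p "vs ! Suc (Suc s)" r]
        by (simp add: p_def)
      moreover have "vs ! Suc (Suc s) ! r = down (x ! r)" using r ls1 same si by (simp add: x_def)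
      ultimately show False using down_less[of "x ! r"] r(2) same si by (simp add: x_def)
    qed
  qed
qed

lemma minimally_skipped_characterization:
  assumes ij: "i < j" "j \<le> n"
  shows "minimally_skipped u w vs i j \<longleftrightarrow>
    (\<exists>k. chain_interval vs i j = {vs ! k} \<and> strong_descent vs ls k) \<or>
    (principal_factor (vs ! j) (vs ! i) \<and>
     ls ! i = off i + principal_index (vs ! j) (vs ! i) \<and>
     first_admissible_chain (vs ! j) (vs ! i) (prefix_embedding (vs ! j) (vs ! i))
       (take (Suc (j - i)) (drop i vs)))"
  (is "_ \<longleftrightarrow> ?a \<or> ?b")
proof
  assume "minimally_skipped u w vs i j"
  then have ms: "Suc i < j" "bad i j" "\<And>k. i < k \<Longrightarrow> k < j \<Longrightarrow> \<not> bad k j" "\<not> bad i (j - 1)"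
    using minimally_skipped_iff[OF ij] by auto
  show "?a \<or> ?b"
  proof (cases "\<exists>m. i < m \<and> m < j \<and> strong_descent vs ls m")
    case True
    then obtain m where m: "i \<le> m" "Suc m < j" "strong_descent vs ls (Suc m)"
      by (metis Suc_le_D Suc_le_eq less_Suc_eq_le)
    have b: "bad m (Suc (Suc m))" using strong_descent_bad[OF _ m(3)] m(2) ij(2) by simp
    then have "bad m j" using bad_mono m(2) ij(2) by simp
    then have mi: "m = i" using ms(3)[of m] m by (cases "m = i") auto
    have "j = Suc (Suc i)"
    proof (rule ccontr)
      assume "j \<noteq> Suc (Suc i)"
      then have "bad i (j - 1)" using bad_mono[OF b, of "j - 1"] mi m(2) ij(2) by auto
      then show False using ms(4) by simp
    qed
    then have "chain_interval vs i j = {vs ! Suc i}"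
      unfolding chain_interval_def by (auto simp: less_Suc_eq)
    then show ?thesis using m(3) mi by blast
  next
    case False
    then show ?thesis using skipped_imp_principal[OF ms(1) ij(2) ms(2-4)] by blast
  qed
next
  assume "?a \<or> ?b"
  then have "Suc i < j \<and> bad i j \<and> (\<forall>k. i < k \<and> k < j \<longrightarrow> \<not> bad k j) \<and> \<not> bad i (j - 1)"
  proof
    assume ?a
    then obtain k where k: "chain_interval vs i j = {vs ! k}" "strong_descent vs ls k" by blast
    then have kn: "k < n" by (simp add: strong_descent_def descent_def)
    have mem: "m = k" if "i < m" "m < j" for m
    proof -
      have "vs ! m \<in> chain_interval vs i j" using that unfolding chain_interval_def by auto
      then show ?thesis using k(1) chain_inj[of m k] that ij kn by simp
    qed
    have sij: "Suc i < j"
    proof (rule ccontr)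
      assume "\<not> Suc i < j"
      then show False using k(1) chain_interval_empty[of j i] by simp
    qed
    then have ki: "k = Suc i" using mem[of "Suc i"] by simp
    have j: "j = Suc (Suc i)"
    proof (rule ccontr)
      assume "j \<noteq> Suc (Suc i)"
      then show False using mem[of "Suc (Suc i)"] ki sij by simp
    qed
    have "bad i j" using strong_descent_bad[of i] k(2) ki kn j by simp
    moreover have "\<not> bad i (j - 1)" "\<not> bad (Suc i) j" using not_bad_Suc[of i] not_bad_Suc[of "Suc i"] j ij by simp_all
    moreover have "k = Suc i" if "i < k" "k < j" for k using that j by simp
    ultimately show ?thesis using sij by blast
  next
    assume ?b
    then show ?thesis using principal_imp_skipped[OF ij] by blast
  qed
  then show "minimally_skipped u w vs i j" using minimally_skipped_iff[OF ij] by blast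
qed

end

theorem theorem4p6:
  fixes u w :: "'a::order list" and vs :: "'a list list" and ls :: "nat list" and i j :: nat
  assumes "rooted_forest TYPE('a)"
    and "u \<noteq> []"
    and "word_le u w"
    and "maximal_chain u w vs"
    and "chain_id vs ls"
    and "i < j" and "j < length vs"
  shows "minimally_skipped u w vs i j \<longleftrightarrow>
    (\<exists>k. chain_interval vs i j = {vs ! k} \<and> strong_descent vs ls k) \<or>
    (principal_factor (vs ! j) (vs ! i) \<and>
     ls ! i = offset (chain_embedding w ls i) + principal_index (vs ! j) (vs ! i) \<and>
     first_admissible_chain (vs ! j) (vs ! i) (prefix_embedding (vs ! j) (vs ! i))
       (take (Suc (j - i)) (drop i vs)))"
proof -
  interpret rooted_forest_order "TYPE('a)" using assms(1) by unfold_locales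
  have "\<forall>v\<in>set vs. v \<noteq> []"
    using maximal_chain_word_le[OF assms(4)] word_le_nonempty assms(2) by blast
  note tr = chain_id_imp_trace[OF assms(5) this]
  have ends: "hd vs = w" "last vs = u" using assms(4) by (auto simp: maximal_chain_def)
  have "vs = trace (0, w) ls" using tr(2) ends(1) by simp
  then have "snd (run (0, w) ls) = u" using ends(2) last_trace by metis
  then interpret word_chain "TYPE('a)" w u vs ls
    using tr ends(1) assms(2) by unfold_locales auto
  have jn: "j \<le> length ls" using assms(7) length_vs by simp
  then show ?thesis
    using minimally_skipped_characterization[OF assms(6) jn] offset_st[of i] assms(6) by simp
qed

end
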